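(* Let $\tilde P_n$ be a scrambled $(0,m,s)$-net in base $b$ (with $b\ge s$, $n=b^m$). Then $H_n(A)\le \mathrm{Vol}(A\times A)=\mathrm{Vol}(A)^2$ for every box $A=\prod_{j=1}^s[a_j,A_j)$ with $0\le a_j<A_j\le 1$, $j=1,\dots,s$. Consequently the pairwise sampling dependence index of $\tilde P_n$ satisfies $\mathcal E_n(\tilde P_n)\le 0$.
   Context: Integers $b\ge 2$, $s\ge 1$, $m\ge 1$ with $b\ge s$; $n=b^m$. A $(0,m,s)$-net in base $b$ is a set $P_n=\{u_1,\dots,u_n\}$ of $n=b^m$ points of $[0,1)^s$ such that for all integers $k_j\ge 0$ with $k_1+\dots+k_s\le m$ and all integers $0\le c_j<b^{k_j}$, the elementary interval $\prod_{j=1}^s[c_jb^{-k_j},(c_j+1)b^{-k_j})$ contains exactly $b^{m-(k_1+\dots+k_s)}$ points of $P_n$. Scrambling is Owen's nested uniform scrambling in base $b$: write each coordinate of each point in base $b$ as $x=0.x_1x_2x_3\ldots$ with $x_i=\lfloor b^ix\rfloor \bmod b$. For each coordinate $j$ and each finite digit string $(x_1,\dots,x_{i-1})$, $i\ge1$, let $\pi_{j;x_1,\dots,x_{i-1}}$ be a uniformly random permutation of $\{0,\dots,b-1\}$, all these permutations being mutually independent; the $i$th digit $x_i$ of the $j$th coordinate of a point is replaced by $\pi_{j;x_1,\dots,x_{i-1}}(x_i)$. The resulting random point set is $\tilde P_n=\{U_1,\dots,U_n\}$; each $U_i$ is uniform on $[0,1)^s$. Let $(U,V)=(U_I,U_L)$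 where $(I,L)$ is chosen uniformly from the ordered pairs of distinct indices in $\{1,\dots,n\}$, independently of the scrambling. For $A\subseteq[0,1)^s$, $H_n(A):=P((U,V)\in A\times A)$. The pairwise sampling dependence index is $\mathcal E_n(\tilde P_n):=\sup_{A\in\mathcal A}\big(H_n(A)-\mathrm{Vol}(A)^2\big)$, where $\mathcal A$ is the set of all boxes $\prod_{j=1}^s[a_j,A_j)$ in $[0,1)^s$. *)

theory Defs
  imports "HOL-Probability.Probability"
begin

definition hbox :: "real ^ 's \<Rightarrow> real ^ 's \<Rightarrow> (real ^ 's::finite) set" where
  "hbox a B = {x. \<forall>j. x $ j \<in> {a $ j ..< B $ j}}"

definition unit_boxes :: "(real ^ 's::finite) set set" where
  "unit_boxes = {hbox a B | a B. \<forall>j. 0 \<le> a $ j \<and> a $ j < B $ j \<and> B $ j \<le> 1}"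

text \<open>A (0,m,s)-net in base b, with s the cardinality of the coordinate type.\<close>

definition zero_net :: "nat \<Rightarrow> nat \<Rightarrow> (real ^ 's::finite) set \<Rightarrow> bool" where
  "zero_net b m P \<longleftrightarrow>
     P \<subseteq> hbox (\<chi> j. 0) (\<chi> j. 1) \<and> card P = b ^ m \<and>
     (\<forall>k c :: 's \<Rightarrow> nat. (\<Sum>j\<in>UNIV. k j) \<le> m \<longrightarrow> (\<forall>j. c j < b ^ k j) \<longrightarrow>
        card (P \<inter> hbox (\<chi> j. real (c j) / real b ^ k j) (\<chi> j. (real (c j) + 1) / real b ^ k j))
          = b ^ (m - (\<Sum>j\<in>UNIV. k j)))"

definition digit :: "nat \<Rightarrow> nat \<Rightarrow> real \<Rightarrow> nat" where
  "digit b i x = nat (\<lfloor>real b ^ i * x\<rfloor> mod int b)"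

text \<open>
  Here \<open>\<rho> ds\<close> is the permutation attached to the string \<open>ds\<close> of preceding digits, most significant
  digit first. The summation index is shifted by one: digit \<open>Suc i\<close> is permuted according to the
  digits \<open>1, \<dots>, i\<close>. The event that the scrambled digits are eventually all \<open>b - 1\<close>, where they are
  not the base-b digits of the sum, has probability zero under nested uniform scrambling.
\<close>

definition scramble_coord :: "nat \<Rightarrow> (nat list \<Rightarrow> nat \<Rightarrow> nat) \<Rightarrow> real \<Rightarrow> real" where
  "scramble_coord b \<rho> x =
     (\<Sum>i. real (\<rho> (map (\<lambda>k. digit b k x) [1..<Suc i]) (digit b (Suc i) x)) / real b ^ Suc i)"

definition scramble :: "nat \<Rightarrow> ('s \<Rightarrow> nat list \<Rightarrow> nat \<Rightarrow> nat) \<Rightarrow> real ^ 's \<Rightarrow> real ^ 's::finite" where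
  "scramble b \<rho> x = (\<chi> j. scramble_coord b (\<rho> j) (x $ j))"

definition perms :: "nat \<Rightarrow> (nat \<Rightarrow> nat) set" where
  "perms b = {p. p permutes {..<b}}"

definition perm_index :: "nat \<Rightarrow> ('s \<times> nat list) set" where
  "perm_index b = UNIV \<times> lists {..<b}"

definition nested_uniform_perms ::
  "'w measure \<Rightarrow> nat \<Rightarrow> ('s::finite \<Rightarrow> nat list \<Rightarrow> 'w \<Rightarrow> nat \<Rightarrow> nat) \<Rightarrow> bool" where
  "nested_uniform_perms M b \<pi> \<longleftrightarrow>
     prob_space.indep_vars M (\<lambda>_. count_space (perms b)) (\<lambda>(j, ds). \<pi> j ds) (perm_index b) \<and>
     (\<forall>(j, ds) \<in> perm_index b.
        distr M (count_space (perms b)) (\<pi> j ds) = uniform_count_measure (perms b))"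

definition distinct_pairs :: "nat \<Rightarrow> (nat \<times> nat) set" where
  "distinct_pairs n = {(i, l). i \<in> {1..n} \<and> l \<in> {1..n} \<and> i \<noteq> l}"

text \<open>
  The index pair is uniform on the ordered pairs of distinct indices, and independent of the whole
  family of permutations, taken jointly as one random variable in the product space. Independence
  is stated for the generated sigma-algebras because \<open>indep_var\<close> needs equal value types.
\<close>

definition independent_uniform_pair ::
  "'w measure \<Rightarrow> nat \<Rightarrow> nat \<Rightarrow> ('s::finite \<Rightarrow> nat list \<Rightarrow> 'w \<Rightarrow> nat \<Rightarrow> nat) \<Rightarrow>
     ('w \<Rightarrow> nat) \<Rightarrow> ('w \<Rightarrow> nat) \<Rightarrow> bool" where
  "independent_uniform_pair M b n \<pi> I L \<longleftrightarrow>
     (\<lambda>\<omega>. (I \<omega>, L \<omega>)) \<in> measurable M (count_space (distinct_pairs n)) \<and>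
     distr M (count_space (distinct_pairs n)) (\<lambda>\<omega>. (I \<omega>, L \<omega>))
       = uniform_count_measure (distinct_pairs n) \<and>
     prob_space.indep_set M
       (sets (vimage_algebra (space M) (\<lambda>\<omega>. \<lambda>(j, ds) \<in> perm_index b. \<pi> j ds \<omega>)
          (PiM (perm_index b) (\<lambda>_. count_space (perms b)))))
       (sets (vimage_algebra (space M) (\<lambda>\<omega>. (I \<omega>, L \<omega>)) (count_space (distinct_pairs n))))"

definition pair_prob ::
  "'w measure \<Rightarrow> ('w \<Rightarrow> real ^ 's) \<Rightarrow> ('w \<Rightarrow> real ^ 's) \<Rightarrow> (real ^ 's::finite) set \<Rightarrow> real" where
  "pair_prob M U V A = \<P>(\<omega> in M. (U \<omega>, V \<omega>) \<in> A \<times> A)"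

text \<open>
  The supremum is over a nonempty set, bounded above by 1 when \<open>M\<close> is a probability space, so the
  real-valued \<open>SUP\<close> is the true supremum.
\<close>

definition sampling_dependence_index ::
  "'w measure \<Rightarrow> ('w \<Rightarrow> real ^ 's) \<Rightarrow> ('w \<Rightarrow> real ^ 's::finite) \<Rightarrow> real" where
  "sampling_dependence_index M U V =
     (SUP A \<in> unit_boxes. pair_prob M U V A - (measure lborel A)\<^sup>2)"

end

theory Submission
  imports Defs
begin

text \<open>
  Replace every side of the box by the union of the level-N cells it meets; N tends to infinity only
  at the very end. For two points whose j-th coordinates share exactly k digits, the probability that
  both scrambled j-th coordinates fall into a grid interval J is a prefix sum
  h(0) + b h(1) + ... + b^k h(k), where the weights h sum to the squared length of J. Counting the
  ordered pairs of net points that agree in at least t(j) digits in each coordinate then turns the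
  claim into
  \<open>0 \<le> (\<Sum>t. (min (b ^ \<bar>t\<bar>) (b ^ m) - 1) * (\<Prod>j. h\<^sub>j (t j)))\<close>.

  The weights of an interval are nonnegative except possibly right below the level at which the
  interval is first split, and that negative weight is dominated both by the weight just before it
  and, up to the factor b - 1, by the total of the weights after it. Convolving with one coordinate
  at a time, starting from \<open>\<phi> k = min (b ^ k) (b ^ m) - 1\<close>, the first convolution keeps the
  function nondecreasing. Each later one lowers by 1 / (b - 1) the constant c with
  \<open>c * \<phi> i \<le> \<phi> j\<close> for \<open>i \<le> j\<close>, and it keeps the function nonnegative as long as
  c is at least 1 / (b - 1). This survives exactly b coordinates, which is where \<open>s \<le> b\<close> enters.
\<close>

section \<open>Convolution with mildly signed weights\<close>

text \<open>If all weights were nonnegative, the claim would be immediate, since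
  \<open>b ^ min m k - 1\<close> is nonnegative. They are not: for b = 2, m >= 2 and the side [1/4,
  3/4) they begin 1/4, -1/8, 1/8, because points sharing exactly one digit are scrambled into the
  two quarters of one half and never both land there. This example attains both bounds on the
  negative weight with equality. The defect occurs once per coordinate for a geometric reason: a
  cell has at most one child cut by the interval, except the cell in which the two ends separate,
  which may have two. The two ways to pay for the negative weight have different prices. Payment by
  the preceding weight is free but needs \<open>\<phi> k - \<phi> (Suc k) / b\<close> to be
  nondecreasing, which the initial function satisfies; payment by the later weights needs only the
  constant c, and lowers it. The free payment for one coordinate is what gains the last admissible
  value s = b. N is kept apart from m because the box is arbitrary, while two net points already
  differ within m digits in every coordinate.\<close>

definition conv :: "nat \<Rightarrow> (nat \<Rightarrow> real) \<Rightarrow> (nat \<Rightarrow> real) \<Rightarrow> nat \<Rightarrow> real" where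
  "conv m h \<phi> k = (\<Sum>t\<le>m. h t * \<phi> (k + t))"

definition mildly_signed :: "nat \<Rightarrow> nat \<Rightarrow> (nat \<Rightarrow> real) \<Rightarrow> bool" where
  "mildly_signed b m h \<longleftrightarrow> (\<exists>k D g. 0 \<le> D \<and> (\<forall>t\<le>m. 0 \<le> g t) \<and> k \<le> m \<and>
     (\<forall>t\<le>m. h t = g t - (if t = Suc k then D else 0)) \<and>
     real b * D \<le> g k \<and> (real b - 1) * D \<le> (\<Sum>t\<in>{k+2..m}. g t))"

text \<open>Interpolates between nonnegative nondecreasing functions (c = 1) and merely nonnegative
  ones (c = 0).\<close>

definition almost_mono :: "real \<Rightarrow> (nat \<Rightarrow> real) \<Rightarrow> bool" where
  "almost_mono c \<phi> \<longleftrightarrow> (\<forall>k. 0 \<le> \<phi> k) \<and> (\<forall>i j. i \<le> j \<longrightarrow> c * \<phi> i \<le> \<phi> j)"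

lemma conv_split:
  assumes b: "2 \<le> b" and "0 \<le> D" and "\<forall>t\<le>m. h t = g t - (if t = Suc k then D else 0)"
    and "(real b - 1) * D \<le> (\<Sum>t\<in>{k+2..m}. g t)"
  shows "conv m h \<phi> i = conv m g \<phi> i - D * \<phi> (i + Suc k)"
proof -
  have "conv m h \<phi> i = (\<Sum>t\<le>m. g t * \<phi> (i + t) - (if t = Suc k then D * \<phi> (i + Suc k) else 0))"
    unfolding conv_def by (rule sum.cong) (auto simp: left_diff_distrib assms(3)[rule_format])
  also have "\<dots> = conv m g \<phi> i - (if Suc k \<le> m then D * \<phi> (i + Suc k) else 0)"
    by (simp add: sum_subtractf conv_def)
  also have "\<dots> = conv m g \<phi> i - D * \<phi> (i + Suc k)"
  proof (cases "Suc k \<le> m")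
    case False
    then have "(real b - 1) * D \<le> 0" using assms(4) by simp
    then have "D = 0" using b \<open>0 \<le> D\<close> by (simp add: mult_le_0_iff)
    then show ?thesis by simp
  qed simp
  finally show ?thesis .
qed

text \<open>The negative entry is charged to the entries after it: these total at least
  \<open>(b - 1) * D\<close> and meet values of \<open>\<phi>\<close> that are at least c times the
  value met by the negative entry. Hence the convolution lies between
  \<open>(1 - 1 / ((b - 1) * c)) * Q\<close> and \<open>Q\<close>, where \<open>Q\<close> is the
  convolution with \<open>g\<close>. Comparing these bounds at two arguments multiplies c by the
  same factor, and the product is \<open>c - 1 / (b - 1)\<close>.\<close>

lemma conv_almost_mono_step:
  assumes b: "2 \<le> b" and h: "mildly_signed b m h" and \<phi>: "almost_mono c \<phi>"
    and c: "1 / (real b - 1) \<le> c"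
  shows "almost_mono (c - 1 / (real b - 1)) (conv m h \<phi>)"
proof -
  obtain k D g where D: "0 \<le> D" and g: "\<forall>t\<le>m. 0 \<le> g t" and k: "k \<le> m"
    and hg: "\<forall>t\<le>m. h t = g t - (if t = Suc k then D else 0)"
    and Dg: "(real b - 1) * D \<le> (\<Sum>t\<in>{k+2..m}. g t)"
    using h unfolding mildly_signed_def by blast
  have b1: "0 < real b - 1" using b by simp
  have cp: "0 < c" using c b1 by (meson divide_pos_pos less_le_trans zero_less_one)
  have \<phi>0: "0 \<le> \<phi> i" for i using \<phi> by (simp add: almost_mono_def)
  have \<phi>c: "c * \<phi> i \<le> \<phi> j" if "i \<le> j" for i j using \<phi> that by (simp add: almost_mono_def)
  define Q where "Q = conv m g \<phi>"
  have H: "conv m h \<phi> i = Q i - D * \<phi> (i + Suc k)" for i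
    unfolding Q_def using conv_split[OF b D hg Dg] .
  have Q0: "0 \<le> Q i" for i unfolding Q_def conv_def using g \<phi>0 by (intro sum_nonneg) auto
  have Qc: "c * Q i \<le> Q j" if "i \<le> j" for i j
    unfolding Q_def conv_def sum_distrib_left
  proof (rule sum_mono)
    fix t assume "t \<in> {..m}"
    then have "g t * (c * \<phi> (i + t)) \<le> g t * \<phi> (j + t)" using g that by (intro mult_left_mono \<phi>c) auto
    then show "c * (g t * \<phi> (i + t)) \<le> g t * \<phi> (j + t)" by (simp add: algebra_simps)
  qed
  have DQ: "D * \<phi> (j + Suc k) \<le> Q j / ((real b - 1) * c)" for j
  proof -
    have "((real b - 1) * D) * (c * \<phi> (j + Suc k)) \<le> (\<Sum>t\<in>{k+2..m}. g t) * (c * \<phi> (j + Suc k))"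
      using Dg cp \<phi>0 by (intro mult_right_mono) auto
    also have "\<dots> \<le> (\<Sum>t\<in>{k+2..m}. g t * \<phi> (j + t))"
      unfolding sum_distrib_right using g by (intro sum_mono mult_left_mono \<phi>c) auto
    also have "\<dots> \<le> Q j"
      unfolding Q_def conv_def using g \<phi>0 by (intro sum_mono2) auto
    finally show ?thesis using b1 cp by (simp add: field_simps)
  qed
  have f0: "0 \<le> 1 - 1 / ((real b - 1) * c)"
    using c b1 cp by (simp add: field_simps)
  have low: "(1 - 1 / ((real b - 1) * c)) * Q j \<le> conv m h \<phi> j" for j
    using DQ[of j] unfolding H by (simp add: algebra_simps)
  show ?thesis unfolding almost_mono_def
  proof (intro conjI allI impI)
    fix j show "0 \<le> conv m h \<phi> j"
      using low[of j] f0 Q0[of j] by (meson mult_nonneg_nonneg order_trans)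
  next
    fix i j :: nat assume ij: "i \<le> j"
    have "(c - 1 / (real b - 1)) * conv m h \<phi> i \<le> (c - 1 / (real b - 1)) * Q i"
      using c D \<phi>0 by (intro mult_left_mono) (auto simp: H)
    also have "\<dots> = (1 - 1 / ((real b - 1) * c)) * (c * Q i)"
      using cp b1 by (simp add: field_simps)
    also have "\<dots> \<le> (1 - 1 / ((real b - 1) * c)) * Q j"
      using f0 Qc[OF ij] by (rule mult_left_mono[rotated])
    also have "\<dots> \<le> conv m h \<phi> j" by (rule low)
    finally show "(c - 1 / (real b - 1)) * conv m h \<phi> i \<le> conv m h \<phi> j" .
  qed
qed

text \<open>Here the negative entry is charged to the entry before it. Setting aside
  \<open>b * D\<close> from \<open>g k\<close> combines the two into
  \<open>b * D * (\<phi> (l + k) - \<phi> (Suc (l + k)) / b)\<close>, nondecreasing in l by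
  assumption, so the convolution is a nonnegative combination of nondecreasing functions and no
  constant is lost.\<close>

lemma conv_almost_mono_first:
  assumes b: "2 \<le> b" and h: "mildly_signed b m h" and \<phi>0: "0 \<le> \<phi> 0" and \<phi>: "mono \<phi>"
    and \<phi>b: "mono (\<lambda>k. \<phi> k - \<phi> (Suc k) / real b)"
  shows "almost_mono 1 (conv m h \<phi>)"
proof -
  obtain k D g where D: "0 \<le> D" and g: "\<forall>t\<le>m. 0 \<le> g t" and k: "k \<le> m"
    and hg: "\<forall>t\<le>m. h t = g t - (if t = Suc k then D else 0)"
    and Dk: "real b * D \<le> g k"
    and Dg: "(real b - 1) * D \<le> (\<Sum>t\<in>{k+2..m}. g t)"
    using h unfolding mildly_signed_def by blast
  have nonneg: "0 \<le> \<phi> i" for i using \<phi>0 \<phi> by (meson le0 monoD order_trans)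
  have "almost_mono 1 \<phi>" using \<phi> nonneg by (auto simp: almost_mono_def dest: monoD)
  \<comment> \<open>Only the nonnegativity is taken from here; the constant is too small for the
    claim.\<close>
  then have pos: "almost_mono (1 - 1 / (real b - 1)) (conv m h \<phi>)"
    using b h by (intro conv_almost_mono_step) auto
  have "conv m h \<phi> i \<le> conv m h \<phi> j" if "i \<le> j" for i j
  proof -
    have split: "conv m h \<phi> l = (\<Sum>t\<in>{..m}-{k}. g t * \<phi> (l + t)) + (g k - real b * D) * \<phi> (l + k)
        + real b * D * (\<phi> (l + k) - \<phi> (Suc (l + k)) / real b)" for l
    proof -
      have "conv m g \<phi> l = g k * \<phi> (l + k) + (\<Sum>t\<in>{..m}-{k}. g t * \<phi> (l + t))"
        unfolding conv_def using k by (subst sum.remove[of _ k]) auto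
      moreover have "real b * D * (\<phi> (l + k) - \<phi> (Suc (l + k)) / real b)
          = real b * D * \<phi> (l + k) - D * \<phi> (Suc (l + k))"
        using b by (simp add: right_diff_distrib)
      ultimately show ?thesis using conv_split[OF b D hg Dg, of \<phi> l] by (simp add: left_diff_distrib)
    qed
    show ?thesis unfolding split
      using that g D Dk by (intro add_mono sum_mono mult_left_mono monoD[OF \<phi>] monoD[OF \<phi>b]) auto
  qed
  then show ?thesis using pos by (simp add: almost_mono_def)
qed

text \<open>The offset \<open>k\<close> is what allows a coordinate to be split off as one
  \<open>conv\<close>; in the end only the value at 0 matters.\<close>

definition multi_conv :: "nat \<Rightarrow> ('s \<Rightarrow> nat \<Rightarrow> real) \<Rightarrow> (nat \<Rightarrow> real) \<Rightarrow> 's set \<Rightarrow> nat \<Rightarrow> real" where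
  "multi_conv m h \<phi> J k = (\<Sum>t\<in>PiE J (\<lambda>_. {..m}). \<phi> (k + (\<Sum>j\<in>J. t j)) * (\<Prod>j\<in>J. h j (t j)))"

lemma multi_conv_insert:
  assumes "finite J" "x \<notin> J"
  shows "multi_conv m h \<phi> (insert x J) = conv m (h x) (multi_conv m h \<phi> J)"
proof
  fix k
  have inj: "inj_on (\<lambda>(y, g). g(x := y)) ({..m} \<times> PiE J (\<lambda>_. {..m}))"
    using assms(2) by (rule inj_combinator)
  have J: "(\<Sum>j\<in>J. if j = x then v else t j) = (\<Sum>j\<in>J. t j)"
    "(\<Prod>j\<in>J. h j (if j = x then v else t j)) = (\<Prod>j\<in>J. h j (t j))" for t :: "'a \<Rightarrow> nat" and v
    using assms(2) by (auto intro!: sum.cong prod.cong)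
  have "multi_conv m h \<phi> (insert x J) k
      = (\<Sum>(v, t)\<in>{..m} \<times> PiE J (\<lambda>_. {..m}). \<phi> (k + (v + (\<Sum>j\<in>J. t j))) * (h x v * (\<Prod>j\<in>J. h j (t j))))"
    unfolding multi_conv_def PiE_insert_eq sum.reindex[OF inj]
    using assms by (auto intro!: sum.cong simp: J fun_upd_def)
  also have "\<dots> = conv m (h x) (multi_conv m h \<phi> J) k"
    unfolding conv_def multi_conv_def sum_distrib_left sum.cartesian_product
    by (auto intro!: sum.cong simp: algebra_simps)
  finally show "multi_conv m h \<phi> (insert x J) k = conv m (h x) (multi_conv m h \<phi> J) k" .
qed

lemma multi_conv_almost_mono:
  assumes b: "2 \<le> b" and h: "\<And>j. mildly_signed b m (h j)" and \<phi>0: "0 \<le> \<phi> 0" and \<phi>: "mono \<phi>"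
    and \<phi>b: "mono (\<lambda>k. \<phi> k - \<phi> (Suc k) / real b)"
    and "finite J" "J \<noteq> {}" "card J \<le> b"
  shows "almost_mono (1 - (real (card J) - 1) / (real b - 1)) (multi_conv m h \<phi> J)"
  using assms(6-8)
proof (induction J rule: finite_ne_induct)
  case (singleton x)
  have "multi_conv m h \<phi> {} = \<phi>" by (rule ext) (simp add: multi_conv_def)
  then have "multi_conv m h \<phi> {x} = conv m (h x) \<phi>" using multi_conv_insert[of "{}" x m h \<phi>] by simp
  then show ?case using conv_almost_mono_first[OF b h \<phi>0 \<phi> \<phi>b] by simp
next
  case (insert x J)
  have c: "1 / (real b - 1) \<le> 1 - (real (card J) - 1) / (real b - 1)"
    using insert.prems insert.hyps b by (simp add: field_simps)
  have "1 - (real (card (insert x J)) - 1) / (real b - 1)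
      = 1 - (real (card J) - 1) / (real b - 1) - 1 / (real b - 1)"
    using insert.hyps by (simp add: add_divide_distrib diff_divide_distrib)
  moreover have "card J \<le> b" using insert by simp
  ultimately show ?case
    using conv_almost_mono_step[OF b h insert.IH c, of x]
    by (simp only: multi_conv_insert[OF insert.hyps(1,3)])
qed

lemma truncated_power_convolution:
  fixes h :: "'s::finite \<Rightarrow> nat \<Rightarrow> real"
  assumes b: "2 \<le> b" and s: "CARD('s) \<le> b" and h: "\<And>j. mildly_signed b m (h j)"
  shows "(\<Sum>t\<in>PiE UNIV (\<lambda>_. {..m}). (real b ^ m - real b ^ min m (\<Sum>j\<in>UNIV. t j)) * (\<Prod>j\<in>UNIV. h j (t j)))
     \<le> (real b ^ m - 1) * (\<Prod>j\<in>UNIV. \<Sum>t\<le>m. h j t)"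
proof -
  define \<phi> where "\<phi> k = real b ^ min m k - 1" for k
  have b1: "1 \<le> real b" using b by simp
  have m: "mono \<phi>" unfolding \<phi>_def by (intro monoI diff_mono power_increasing) (use b1 in auto)
  have mb: "mono (\<lambda>k. \<phi> k - \<phi> (Suc k) / real b)"
  proof -
    \<comment> \<open>Below m the growth is exactly geometric and the powers cancel; from m on the
      truncation stops the subtracted term from growing, so the difference jumps upwards
      once.\<close>
    have e: "\<phi> k - \<phi> (Suc k) / real b = (if k < m then 0 else real b ^ m * (1 - 1 / real b)) - (1 - 1 / real b)" for k
    proof (cases "k < m")
      case True
      then have "min m k = k" "min m (Suc k) = Suc k" by auto
      then show ?thesis using b1 True by (simp add: \<phi>_def diff_divide_distrib)
    next
      case False
      then have "min m k = m" "min m (Suc k) = m" by auto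
      then show ?thesis using False by (simp add: \<phi>_def algebra_simps diff_divide_distrib)
    qed
    show ?thesis unfolding e using b1 by (intro monoI) auto
  qed
  have "almost_mono (1 - (real CARD('s) - 1) / (real b - 1)) (multi_conv m h \<phi> UNIV)"
    by (rule multi_conv_almost_mono[OF b h _ m mb]) (use s in \<open>auto simp: \<phi>_def\<close>)
  then have "0 \<le> multi_conv m h \<phi> UNIV 0" by (simp add: almost_mono_def)
  also have "multi_conv m h \<phi> UNIV 0 = (real b ^ m - 1) * (\<Sum>t\<in>PiE UNIV (\<lambda>_. {..m}). \<Prod>j\<in>UNIV. h j (t j))
     - (\<Sum>t\<in>PiE UNIV (\<lambda>_. {..m}). (real b ^ m - real b ^ min m (\<Sum>j\<in>UNIV. t j)) * (\<Prod>j\<in>UNIV. h j (t j)))"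
    unfolding multi_conv_def \<phi>_def sum_distrib_left sum_subtractf[symmetric]
    by (intro sum.cong) (auto simp: algebra_simps)
  also have "(\<Sum>t\<in>PiE UNIV (\<lambda>_. {..m}). \<Prod>j\<in>UNIV. h j (t j)) = (\<Prod>j\<in>UNIV. \<Sum>t\<le>m. h j t)"
    by (subst prod_sum_PiE) auto
  finally show ?thesis by simp
qed

section \<open>Pair counts of intervals on the b-adic grid\<close>

definition occ :: "nat set \<Rightarrow> nat \<Rightarrow> nat \<Rightarrow> real" where
  "occ J L e = real (card {x \<in> J. x div L = e})"

text \<open>
  Divided by \<open>b ^ (2 * N)\<close>, this is the area of the part of the square over J on which both
  coordinates have the same first k digits.
\<close>

definition energy :: "nat set \<Rightarrow> nat \<Rightarrow> nat \<Rightarrow> nat \<Rightarrow> real" where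
  "energy J b N k = (\<Sum>e<b ^ k. (occ J (b ^ (N - k)) e)\<^sup>2)"

lemma div_child: "x div (b * M) = e \<longleftrightarrow> x div M \<in> {e * b..<e * b + b}" if "0 < b" for x b M e :: nat
proof -
  have "x div (b * M) = x div M div b" by (metis div_mult2_eq mult.commute)
  moreover have "y div b = e \<longleftrightarrow> y \<in> {e * b..<e * b + b}" for y
    using that dividend_less_div_times[of b y] by (auto intro: div_nat_eqI simp: algebra_simps)
  ultimately show ?thesis by simp
qed

lemma occ_split:
  assumes "finite J" "0 < b"
  shows "occ J (b * M) e = (\<Sum>c\<in>{e * b..<e * b + b}. occ J M c)"
proof -
  have "{x \<in> J. x div (b * M) = e} = (\<Union>c\<in>{e * b..<e * b + b}. {x \<in> J. x div M = c})"
    using div_child[OF assms(2)] by auto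
  also have "card \<dots> = (\<Sum>c\<in>{e * b..<e * b + b}. card {x \<in> J. x div M = c})"
    by (rule card_UN_disjoint) (use assms in auto)
  finally show ?thesis by (simp add: occ_def)
qed

lemma div_block: "{x. x div M = c} = {c * M..<c * M + M}" if "0 < M" for c M :: nat
  using that dividend_less_div_times[of M] by (auto intro: div_nat_eqI simp: algebra_simps)

lemma occ_bounds: "0 \<le> occ J M c" "0 < M \<Longrightarrow> occ J M c \<le> real M"
proof -
  assume M: "0 < M"
  have "card {x \<in> J. x div M = c} \<le> card {x. x div M = c}"
    by (rule card_mono) (simp add: div_block[OF M], blast)
  then show "occ J M c \<le> real M" by (simp add: occ_def div_block[OF M])
qed (simp add: occ_def)

text \<open>The exempted cell on the right is that of the excluded point \<open>\<beta>\<close>, not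
  of \<open>\<beta> - 1\<close>: a cell that ends just before \<open>\<beta>\<close> is thereby
  still covered by the dichotomy.\<close>

lemma occ_interval_full_or_empty:
  assumes "0 < M" "c \<noteq> \<alpha> div M" "c \<noteq> \<beta> div M"
  shows "occ {\<alpha>..<\<beta>} M c = 0 \<or> occ {\<alpha>..<\<beta>} M c = real M"
proof -
  have e: "{x \<in> {\<alpha>..<\<beta>}. x div M = c} = {\<alpha>..<\<beta>} \<inter> {c * M..<c * M + M}"
    unfolding div_block[OF assms(1), of c, symmetric] by blast
  have "\<not> (c * M \<le> \<alpha> \<and> \<alpha> < c * M + M)" "\<not> (c * M \<le> \<beta> \<and> \<beta> < c * M + M)"
    using assms div_block[OF assms(1), of c] by auto
  then consider "c * M + M \<le> \<alpha> \<or> \<beta> \<le> c * M" | "\<alpha> \<le> c * M" "c * M + M \<le> \<beta>" by linarith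
  then show ?thesis
  proof cases
    case 1
    then have "{\<alpha>..<\<beta>} \<inter> {c * M..<c * M + M} = {}" by auto
    then show ?thesis unfolding occ_def e by (simp del: Int_atLeastLessThan)
  next
    case 2
    then have "{\<alpha>..<\<beta>} \<inter> {c * M..<c * M + M} = {c * M..<c * M + M}" by auto
    then show ?thesis unfolding occ_def e by (simp del: Int_atLeastLessThan)
  qed
qed

section \<open>Energies of a finite set at consecutive levels\<close>

lemma power_diff_step: "k < N \<Longrightarrow> b ^ (N - k) = b * b ^ (N - Suc k)" for b :: nat
  by (metis Suc_diff_Suc power_Suc)

lemma sum_children:
  fixes f :: "nat \<Rightarrow> real"
  shows "(\<Sum>c<b ^ Suc k. f c) = (\<Sum>e<b ^ k. \<Sum>c\<in>{e * b..<e * b + b}. f c)"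
  by (simp add: sum.nat_group mult.commute)

lemma energy_Suc: "energy J b N (Suc k) = (\<Sum>e<b ^ k. \<Sum>c\<in>{e * b..<e * b + b}. (occ J (b ^ (N - Suc k)) c)\<^sup>2)"
  unfolding energy_def by (rule sum_children)

lemma energy_split:
  assumes "finite J" "0 < b" "k < N"
  shows "energy J b N k = (\<Sum>e<b ^ k. (\<Sum>c\<in>{e * b..<e * b + b}. occ J (b ^ (N - Suc k)) c)\<^sup>2)"
  unfolding energy_def power_diff_step[OF assms(3)] using assms by (simp add: occ_split)

lemma sum_squares_le_square_sum:
  fixes f :: "'a \<Rightarrow> real"
  assumes "finite K" "\<And>c. c \<in> K \<Longrightarrow> 0 \<le> f c"
  shows "(\<Sum>c\<in>K. (f c)\<^sup>2) \<le> (sum f K)\<^sup>2"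
  using assms
proof induction
  case (insert x F)
  have "0 \<le> f x * sum f F" using insert.prems by (simp add: sum_nonneg)
  then show ?case using insert by (simp add: power2_sum)
qed simp

lemma energy_Suc_le:
  assumes "finite J" "0 < b" "k < N"
  shows "energy J b N (Suc k) \<le> energy J b N k"
  unfolding energy_Suc energy_split[OF assms]
  by (intro sum_mono sum_squares_le_square_sum) (simp_all add: occ_bounds)

text \<open>Cauchy-Schwarz over the b children of each cell. This inequality makes the tail sums of
  the weights nonnegative.\<close>

lemma energy_le_Suc:
  assumes "finite J" "0 < b" "k < N"
  shows "energy J b N k \<le> real b * energy J b N (Suc k)"
proof -
  have "(sum f K)\<^sup>2 \<le> real (card K) * (\<Sum>c\<in>K. (f c)\<^sup>2)" for K :: "nat set" and f :: "nat \<Rightarrow> real"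
    using Cauchy_Schwarz_ineq_sum[of f "\<lambda>_. 1" K] by (simp add: mult.commute)
  from this[of _ "{e * b..<e * b + b}" for e] show ?thesis
    unfolding energy_Suc energy_split[OF assms] sum_distrib_left[of "real b" _ "{..<b ^ k}"]
    by (intro sum_mono) (simp del: sum.op_ivl_Suc)
qed

text \<open>The second bound is the first one applied to the complements \<open>L - w c\<close>. It
  is exact when all entries equal \<open>L\<close>, as the first is when all of them vanish.\<close>

lemma sum_sq_complement:
  fixes w :: "nat \<Rightarrow> real"
  assumes "finite K" "\<And>c. c \<in> K \<Longrightarrow> 0 \<le> w c" "\<And>c. c \<in> K \<Longrightarrow> w c \<le> L"
  shows "(\<Sum>c\<in>K. (w c)\<^sup>2) \<le> (sum w K)\<^sup>2"
    and "(\<Sum>c\<in>K. (w c)\<^sup>2) \<le> (real (card K) * L - sum w K)\<^sup>2 - real (card K) * L\<^sup>2 + 2 * L * sum w K"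
proof -
  show "(\<Sum>c\<in>K. (w c)\<^sup>2) \<le> (sum w K)\<^sup>2" using assms by (intro sum_squares_le_square_sum)
  have "(\<Sum>c\<in>K. (L - w c)\<^sup>2) \<le> (\<Sum>c\<in>K. L - w c)\<^sup>2"
    using assms by (intro sum_squares_le_square_sum) auto
  moreover have "(\<Sum>c\<in>K. (L - w c)\<^sup>2) = real (card K) * L\<^sup>2 + (\<Sum>c\<in>K. (w c)\<^sup>2) - 2 * L * sum w K"
    by (simp add: power2_diff sum.distrib sum_subtractf sum_distrib_left)
  ultimately show "(\<Sum>c\<in>K. (w c)\<^sup>2) \<le> (real (card K) * L - sum w K)\<^sup>2 - real (card K) * L\<^sup>2 + 2 * L * sum w K"
    by (simp add: sum_subtractf)
qed

text \<open>An empty child contributes nothing. For a full one the complement vanishes, and its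
  hypothesis reduces to \<open>b * g c <= M\<^sup>2\<close>. So only the number \<open>a\<close> of
  full children enters.\<close>

lemma full_or_empty_sums:
  fixes w g :: "nat \<Rightarrow> real"
  assumes "finite K" "\<And>c. c \<in> K \<Longrightarrow> w c = 0 \<or> w c = M" "\<And>c. c \<in> K \<Longrightarrow> g c \<le> (w c)\<^sup>2"
    "\<And>c. c \<in> K \<Longrightarrow> b * g c \<le> b * (M - w c)\<^sup>2 - M\<^sup>2 + 2 * w c * M" "0 < b"
  obtains a :: nat where "a \<le> card K" "sum w K = real a * M" "(\<Sum>c\<in>K. (w c)\<^sup>2) = real a * M\<^sup>2"
    "b * sum g K \<le> real a * M\<^sup>2"
proof
  let ?F = "{c \<in> K. w c = M \<and> w c \<noteq> 0}"
  show "card ?F \<le> card K" using assms(1) by (intro card_mono) auto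
  have K: "sum f K = real (card ?F) * v" if "\<And>c. c \<in> ?F \<Longrightarrow> f c = v" "\<And>c. c \<in> K - ?F \<Longrightarrow> f c = 0" for f :: "nat \<Rightarrow> real" and v
  proof -
    have "sum f K = sum f ?F" using that(2) assms(1) by (intro sum.mono_neutral_right) auto
    then show ?thesis using that(1) by simp
  qed
  show "sum w K = real (card ?F) * M" by (rule K) (use assms in auto)
  show "(\<Sum>c\<in>K. (w c)\<^sup>2) = real (card ?F) * M\<^sup>2" by (rule K) (use assms in auto)
  have "b * sum g K \<le> (\<Sum>c\<in>K. if c \<in> ?F then M\<^sup>2 else 0)"
    unfolding sum_distrib_left
  proof (rule sum_mono)
    fix c assume c: "c \<in> K"
    show "b * g c \<le> (if c \<in> ?F then M\<^sup>2 else 0)"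
    proof (cases "w c = 0")
      case True
      then have "g c \<le> 0" using assms(3)[OF c] by simp
      then show ?thesis using True \<open>0 < b\<close> by (auto simp: mult_le_0_iff)
    next
      case False
      then have "w c = M" using assms(2) c by blast
      then show ?thesis using assms(4)[OF c] c False by (simp add: power2_eq_square)
    qed
  qed
  also have "\<dots> = real (card ?F) * M\<^sup>2" by (rule K) auto
  finally show "b * sum g K \<le> real (card ?F) * M\<^sup>2" .
qed

text \<open>
  In the next two lemmas w gives the counts of the children of a cell and g the sums of squared counts
  of their children. Both sides are quadratic in the number of full children, so by convexity
  only the two extreme numbers matter: there the bounds on g by w and by its complement
  \<open>M - w\<close> respectively suffice.
\<close>

lemma cell_ineq_one_partial:
  fixes w g :: "nat \<Rightarrow> real"
  assumes K: "finite K" "card K = b" and p: "p \<in> K"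
    and w: "\<And>c. c \<in> K - {p} \<Longrightarrow> w c = 0 \<or> w c = M"
    and g1: "\<And>c. c \<in> K \<Longrightarrow> g c \<le> (w c)\<^sup>2"
    and g2: "\<And>c. c \<in> K \<Longrightarrow> real b * g c \<le> real b * (M - w c)\<^sup>2 - M\<^sup>2 + 2 * w c * M"
  shows "(sum w K)\<^sup>2 + real b * sum g K \<le> (real b + 1) * (\<Sum>c\<in>K. (w c)\<^sup>2)"
proof -
  have b: "0 < b" using K p card_gt_0_iff by blast
  obtain a where a: "a \<le> card (K - {p})" "sum w (K - {p}) = real a * M"
    "(\<Sum>c\<in>K - {p}. (w c)\<^sup>2) = real a * M\<^sup>2" "real b * sum g (K - {p}) \<le> real a * M\<^sup>2"
    by (rule full_or_empty_sums[of "K - {p}" w M g "real b"]) (use K w g1 g2 b in auto)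
  have s: "sum f K = f p + sum f (K - {p})" for f :: "nat \<Rightarrow> real"
    using K p by (simp add: sum.remove)
  define A B f G where "A = real a" and "B = real b - 1" and "f = w p" and "G = g p"
  have A: "0 \<le> A" "A \<le> B" using a(1) K p b by (auto simp: A_def B_def)
  have G: "G \<le> f\<^sup>2" "(B + 1) * G \<le> (B + 1) * (M - f)\<^sup>2 - M\<^sup>2 + 2 * f * M"
    using g1[OF p] g2[OF p] by (auto simp: G_def f_def B_def)
  have "A\<^sup>2 * M\<^sup>2 + 2 * A * M * f + (B + 1) * G \<le> (B + 1) * A * M\<^sup>2 + (B + 1) * f\<^sup>2"
  proof (cases "B = 0")
    case True
    then show ?thesis using A G by simp
  next
    case False
    then have B: "0 < B" using A by simp
    \<comment> \<open>The bound by \<open>f\<close> belongs to the end \<open>A = 0\<close>, the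
      complementary one to \<open>A = B\<close>; \<open>B - A\<close> and \<open>A\<close> are the
      interpolation weights. The convexity gap is
      \<open>A * B * (B - A) * M\<^sup>2\<close>.\<close>
    have "(B - A) * ((B + 1) * G) + A * ((B + 1) * G)
      \<le> (B - A) * ((B + 1) * f\<^sup>2) + A * ((B + 1) * (M - f)\<^sup>2 - M\<^sup>2 + 2 * f * M)"
      using A G B by (intro add_mono mult_left_mono) auto
    moreover have "0 \<le> A * B * (B - A) * M\<^sup>2" using A B by simp
    ultimately have "B * (A\<^sup>2 * M\<^sup>2 + 2 * A * M * f + (B + 1) * G) \<le> B * ((B + 1) * A * M\<^sup>2 + (B + 1) * f\<^sup>2)"
      by (simp add: algebra_simps power2_eq_square)
    then show ?thesis using B by simp
  qed
  then have "(f + A * M)\<^sup>2 + (real b * G + A * M\<^sup>2) \<le> (real b + 1) * (f\<^sup>2 + A * M\<^sup>2)"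
    by (simp add: B_def algebra_simps power2_eq_square)
  then show ?thesis using a(4) unfolding s a(2,3) A_def f_def G_def by (simp add: algebra_simps)
qed

lemma cell_ineq_two_partial:
  fixes w g :: "nat \<Rightarrow> real"
  assumes K: "finite K" "card K = b" and p: "p \<in> K" "q \<in> K" "p \<noteq> q"
    and w: "\<And>c. c \<in> K - {p, q} \<Longrightarrow> w c = 0 \<or> w c = M"
    and g1: "\<And>c. c \<in> K \<Longrightarrow> g c \<le> (w c)\<^sup>2"
    and g2: "\<And>c. c \<in> K \<Longrightarrow> real b * g c \<le> real b * (M - w c)\<^sup>2 - M\<^sup>2 + 2 * w c * M"
  shows "(real b - 1) * (sum w K)\<^sup>2 + real b * (real b - 2) * sum g K \<le> ((real b)\<^sup>2 - 2) * (\<Sum>c\<in>K. (w c)\<^sup>2)"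
proof -
  have b: "2 \<le> b" using card_mono[of K "{p, q}"] K p by simp
  obtain a where a: "a \<le> card (K - {p, q})" "sum w (K - {p, q}) = real a * M"
    "(\<Sum>c\<in>K - {p, q}. (w c)\<^sup>2) = real a * M\<^sup>2" "real b * sum g (K - {p, q}) \<le> real a * M\<^sup>2"
    by (rule full_or_empty_sums[of "K - {p, q}" w M g "real b"]) (use K w g1 g2 b in auto)
  have s: "sum f K = f p + f q + sum f (K - {p, q})" for f :: "nat \<Rightarrow> real"
    using K p sum.subset_diff[of "{p, q}" K f] by simp
  define A B X Y G where "A = real a" and "B = real b - 2" and "X = w p" and "Y = w q" and "G = g p + g q"
  have "card (K - {p, q}) = b - 2" using K p by (simp add: card_Diff_subset)
  then have A: "0 \<le> A" "A \<le> B" using a(1) b by (auto simp: A_def B_def)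
  have G1: "G \<le> X\<^sup>2 + Y\<^sup>2" using g1 p by (auto simp: G_def X_def Y_def intro: add_mono)
  have G2: "(B + 2) * G \<le> (B + 2) * ((M - X)\<^sup>2 + (M - Y)\<^sup>2) - 2 * M\<^sup>2 + 2 * (X + Y) * M"
    using add_mono[OF g2[OF p(1)] g2[OF p(2)]] by (simp add: G_def X_def Y_def B_def algebra_simps)
  \<comment> \<open>The claim as a function of a real number \<open>z\<close> of full children, with
    leading coefficient \<open>(B + 1) * M\<^sup>2\<close>. At both ends it turns out to be at most
    \<open>- (B + 1) * (X - Y)\<^sup>2\<close>.\<close>
  define E where "E z = (B + 1) * (X + Y + z * M)\<^sup>2 + (B + 2) * B * G + B * (z * M\<^sup>2)
      - ((B + 2)\<^sup>2 - 2) * (X\<^sup>2 + Y\<^sup>2 + z * M\<^sup>2)" for z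
  have "E 0 \<le> (B + 1) * ((X + Y)\<^sup>2 - 2 * (X\<^sup>2 + Y\<^sup>2))"
  proof -
    have "(B + 2) * B * G \<le> (B + 2) * B * (X\<^sup>2 + Y\<^sup>2)" using G1 A by (intro mult_left_mono) auto
    then show ?thesis by (simp add: E_def algebra_simps power2_eq_square)
  qed
  also have "(X + Y)\<^sup>2 - 2 * (X\<^sup>2 + Y\<^sup>2) = - ((X - Y)\<^sup>2)" by (simp add: algebra_simps power2_eq_square)
  finally have e0: "E 0 \<le> (B + 1) * - ((X - Y)\<^sup>2)" .
  have pos: "0 \<le> (B + 1) * (X - Y)\<^sup>2" using A by simp
  then have E0: "E 0 \<le> 0" using e0 by linarith
  have "E B \<le> (B + 1) * ((2 * M - X - Y)\<^sup>2 - 2 * ((M - X)\<^sup>2 + (M - Y)\<^sup>2))"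
  proof -
    have "B * ((B + 2) * G) \<le> B * ((B + 2) * ((M - X)\<^sup>2 + (M - Y)\<^sup>2) - 2 * M\<^sup>2 + 2 * (X + Y) * M)"
      using G2 A by (intro mult_left_mono) auto
    then show ?thesis by (simp add: E_def algebra_simps power2_eq_square)
  qed
  also have "(2 * M - X - Y)\<^sup>2 - 2 * ((M - X)\<^sup>2 + (M - Y)\<^sup>2) = - ((X - Y)\<^sup>2)"
    by (simp add: algebra_simps power2_eq_square)
  finally have "E B \<le> (B + 1) * - ((X - Y)\<^sup>2)" .
  then have EB: "E B \<le> 0" using pos by linarith
  have "E A \<le> 0"
  proof (cases "B = 0")
    case True
    then show ?thesis using A E0 by simp
  next
    case False
    then have B: "0 < B" using A by simp
    have "B * E A = (B - A) * E 0 + A * E B - (B + 1) * M\<^sup>2 * (A * (B * (B - A)))"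
      by (simp add: E_def algebra_simps power2_eq_square)
    moreover have "(B - A) * E 0 \<le> 0" using A E0 by (intro mult_nonneg_nonpos) auto
    moreover have "A * E B \<le> 0" using A EB by (intro mult_nonneg_nonpos) auto
    moreover have "0 \<le> (B + 1) * M\<^sup>2 * (A * (B * (B - A)))" using A B by simp
    ultimately have "B * E A \<le> 0" by linarith
    then show ?thesis using B by (simp add: mult_le_0_iff)
  qed
  moreover have "B * (real b * sum g (K - {p, q})) \<le> B * (A * M\<^sup>2)"
    using a(4) A by (intro mult_left_mono) (auto simp: A_def)
  ultimately show ?thesis
    unfolding s a(2,3) E_def A_def B_def X_def Y_def G_def by (simp add: algebra_simps power2_eq_square)
qed

text \<open>Supplies the two hypotheses on \<open>g\<close> of the cell inequalities. The complement
  bound is multiplied by b so that the length of the child itself appears, which is b times that of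
  its own children.\<close>

lemma energy_block:
  assumes "finite J" "0 < b" "Suc k < N"
  shows "(\<Sum>d\<in>{c * b..<c * b + b}. (occ J (b ^ (N - Suc (Suc k))) d)\<^sup>2) \<le> (occ J (b ^ (N - Suc k)) c)\<^sup>2"
    and "real b * (\<Sum>d\<in>{c * b..<c * b + b}. (occ J (b ^ (N - Suc (Suc k))) d)\<^sup>2)
      \<le> real b * (real (b ^ (N - Suc k)) - occ J (b ^ (N - Suc k)) c)\<^sup>2 - (real (b ^ (N - Suc k)))\<^sup>2
        + 2 * occ J (b ^ (N - Suc k)) c * real (b ^ (N - Suc k))"
proof -
  let ?K = "{c * b..<c * b + b}" and ?L = "b ^ (N - Suc (Suc k))"
  let ?S = "\<Sum>d\<in>?K. (occ J ?L d)\<^sup>2" and ?o = "occ J (b ^ (N - Suc k)) c"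
  have M: "b ^ (N - Suc k) = b * ?L" using power_diff_step[OF assms(3)] .
  have o: "sum (occ J ?L) ?K = ?o" unfolding M using occ_split[OF assms(1,2)] by simp
  have w: "0 \<le> occ J ?L d" "occ J ?L d \<le> real ?L" for d
    using occ_bounds(1)[of J ?L d] occ_bounds(2)[of ?L J d] assms(2) by simp_all
  note sc = sum_sq_complement[of ?K "occ J ?L" "real ?L"]
  show "?S \<le> ?o\<^sup>2" using sc(1) w o by simp
  have "?S \<le> (real b * real ?L - ?o)\<^sup>2 - real b * (real ?L)\<^sup>2 + 2 * real ?L * ?o"
    using sc(2) w o by simp
  then have "real b * ?S \<le> real b * ((real b * real ?L - ?o)\<^sup>2 - real b * (real ?L)\<^sup>2 + 2 * real ?L * ?o)"
    by (intro mult_left_mono) auto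
  also have "\<dots> = real b * (real (b * ?L) - ?o)\<^sup>2 - (real (b * ?L))\<^sup>2 + 2 * ?o * real (b * ?L)"
    by (simp add: algebra_simps power2_eq_square)
  finally show "real b * ?S \<le> real b * (real (b ^ (N - Suc k)) - ?o)\<^sup>2 - (real (b ^ (N - Suc k)))\<^sup>2
        + 2 * ?o * real (b ^ (N - Suc k))" unfolding M .
qed

lemma energy_three_levels:
  "energy J b N (Suc (Suc k))
    = (\<Sum>e<b ^ k. \<Sum>c\<in>{e * b..<e * b + b}. \<Sum>d\<in>{c * b..<c * b + b}. (occ J (b ^ (N - Suc (Suc k))) d)\<^sup>2)"
  unfolding energy_Suc sum_children ..

text \<open>In terms of the tail sums \<open>T\<close> of the weights this says
  \<open>T (k + 2) <= T (k + 1)\<close>, so the weight at \<open>k + 1\<close> is nonnegative. Once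
  the two ends lie in different level-k cells, every cell of that level has at most one child that
  is neither full nor empty.\<close>

lemma energy_interval_concave:
  assumes b: "2 \<le> b" and k: "Suc k < N" and ab: "\<alpha> < \<beta>"
    and split: "\<alpha> div b ^ (N - k) \<noteq> (\<beta> - 1) div b ^ (N - k)"
  shows "energy {\<alpha>..<\<beta>} b N k + real b * energy {\<alpha>..<\<beta>} b N (Suc (Suc k))
    \<le> (real b + 1) * energy {\<alpha>..<\<beta>} b N (Suc k)"
proof -
  have b0: "0 < b" and kN: "k < N" using b k by auto
  let ?M = "b ^ (N - Suc k)"
  have M: "b ^ (N - k) = b * ?M" using power_diff_step[OF kN] .
  have M0: "0 < ?M" using b0 by simp
  have "energy {\<alpha>..<\<beta>} b N k + real b * energy {\<alpha>..<\<beta>} b N (Suc (Suc k))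
    = (\<Sum>e<b ^ k. (\<Sum>c\<in>{e * b..<e * b + b}. occ {\<alpha>..<\<beta>} ?M c)\<^sup>2
       + real b * (\<Sum>c\<in>{e * b..<e * b + b}. \<Sum>d\<in>{c * b..<c * b + b}. (occ {\<alpha>..<\<beta>} (b ^ (N - Suc (Suc k))) d)\<^sup>2))"
    using energy_split[OF finite_atLeastLessThan b0 kN] energy_three_levels
    by (simp add: sum.distrib sum_distrib_left)
  also have "\<dots> \<le> (\<Sum>e<b ^ k. (real b + 1) * (\<Sum>c\<in>{e * b..<e * b + b}. (occ {\<alpha>..<\<beta>} ?M c)\<^sup>2))"
  proof (rule sum_mono)
    fix e assume "e \<in> {..<b ^ k}"
    let ?K = "{e * b..<e * b + b}"
    \<comment> \<open>The split is assumed for the last point \<open>\<beta> - 1\<close>, but the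
      exempted child is that of \<open>\<beta>\<close>. A parent containing both
      \<open>\<alpha>\<close> and \<open>\<beta>\<close> contains \<open>\<beta> - 1\<close> as
      well.\<close>
    have nb: "\<not> (\<alpha> div ?M \<in> ?K \<and> \<beta> div ?M \<in> ?K)"
    proof
      assume "\<alpha> div ?M \<in> ?K \<and> \<beta> div ?M \<in> ?K"
      then have e: "\<alpha> div b ^ (N - k) = e" "\<beta> div b ^ (N - k) = e"
        using div_child[OF b0] M by auto
      have "\<alpha> div b ^ (N - k) \<le> (\<beta> - 1) div b ^ (N - k)" "(\<beta> - 1) div b ^ (N - k) \<le> \<beta> div b ^ (N - k)"
        using ab by (auto intro!: div_le_mono)
      then show False using split e by simp
    qed
    then obtain p where p: "p \<in> ?K" "\<And>c. c \<in> ?K - {p} \<Longrightarrow> c \<noteq> \<alpha> div ?M \<and> c \<noteq> \<beta> div ?M"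
    proof (cases "\<alpha> div ?M \<in> ?K")
      case True
      then show thesis using that[of "\<alpha> div ?M"] nb by auto
    next
      case F: False
      show thesis
      proof (cases "\<beta> div ?M \<in> ?K")
        case True
        then show thesis using that[of "\<beta> div ?M"] F by auto
      next
        case False
        then show thesis using that[of "e * b"] F b by auto
      qed
    qed
    show "(\<Sum>c\<in>?K. occ {\<alpha>..<\<beta>} ?M c)\<^sup>2
       + real b * (\<Sum>c\<in>?K. \<Sum>d\<in>{c * b..<c * b + b}. (occ {\<alpha>..<\<beta>} (b ^ (N - Suc (Suc k))) d)\<^sup>2)
      \<le> (real b + 1) * (\<Sum>c\<in>?K. (occ {\<alpha>..<\<beta>} ?M c)\<^sup>2)"
      by (rule cell_ineq_one_partial[OF _ _ p(1), where M = "real ?M"])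
        (use p(2) occ_interval_full_or_empty[OF M0] energy_block[OF finite_atLeastLessThan b0 k] in auto)
  qed
  also have "\<dots> = (real b + 1) * energy {\<alpha>..<\<beta>} b N (Suc k)"
    unfolding energy_Suc sum_distrib_left ..
  finally show ?thesis .
qed

text \<open>No separation of the ends is assumed, so one parent may have two partial children. The
  coefficients are those of \<open>(b - 2) * T (k + 2) <= (b - 1) * T (k + 1)\<close> for the tail
  sums \<open>T\<close>, that is, \<open>(b - 1) * (T (k + 2) - T (k + 1)) <= T (k + 2)\<close>: the
  later weights outweigh the deficit b - 1 times.\<close>

lemma energy_interval_split_level:
  assumes b: "2 \<le> b" and k: "Suc k < N"
  shows "(real b - 1) * energy {\<alpha>..<\<beta>} b N k + real b * (real b - 2) * energy {\<alpha>..<\<beta>} b N (Suc (Suc k))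
    \<le> ((real b)\<^sup>2 - 2) * energy {\<alpha>..<\<beta>} b N (Suc k)"
proof -
  have b0: "0 < b" and kN: "k < N" using b k by auto
  let ?M = "b ^ (N - Suc k)"
  have M0: "0 < ?M" using b0 by simp
  have "(real b - 1) * energy {\<alpha>..<\<beta>} b N k + real b * (real b - 2) * energy {\<alpha>..<\<beta>} b N (Suc (Suc k))
    = (\<Sum>e<b ^ k. (real b - 1) * (\<Sum>c\<in>{e * b..<e * b + b}. occ {\<alpha>..<\<beta>} ?M c)\<^sup>2
       + real b * (real b - 2) * (\<Sum>c\<in>{e * b..<e * b + b}. \<Sum>d\<in>{c * b..<c * b + b}. (occ {\<alpha>..<\<beta>} (b ^ (N - Suc (Suc k))) d)\<^sup>2))"
    using energy_split[OF finite_atLeastLessThan b0 kN] energy_three_levels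
    by (simp only: sum.distrib sum_distrib_left)
  also have "\<dots> \<le> (\<Sum>e<b ^ k. ((real b)\<^sup>2 - 2) * (\<Sum>c\<in>{e * b..<e * b + b}. (occ {\<alpha>..<\<beta>} ?M c)\<^sup>2))"
  proof (rule sum_mono)
    fix e assume "e \<in> {..<b ^ k}"
    let ?K = "{e * b..<e * b + b}"
    have two: "e * b \<in> ?K" "Suc (e * b) \<in> ?K" using b by auto
    obtain p q where pq: "p \<in> ?K" "q \<in> ?K" "p \<noteq> q"
      "\<And>c. c \<in> ?K - {p, q} \<Longrightarrow> c \<noteq> \<alpha> div ?M \<and> c \<noteq> \<beta> div ?M"
    proof -
      \<comment> \<open>The endpoint children where they lie in the cell, padded to two distinct
        ones by its first two children, which exist since b >= 2.\<close>
      define p where "p = (if \<alpha> div ?M \<in> ?K then \<alpha> div ?M else if \<beta> div ?M = e * b then Suc (e * b) else e * b)"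
      define q where "q = (if \<beta> div ?M \<in> ?K \<and> \<beta> div ?M \<noteq> p then \<beta> div ?M else if p = e * b then Suc (e * b) else e * b)"
      show thesis
        by (rule that[of p q]) (use two in \<open>auto simp: p_def q_def split: if_splits\<close>)
    qed
    show "(real b - 1) * (\<Sum>c\<in>?K. occ {\<alpha>..<\<beta>} ?M c)\<^sup>2
       + real b * (real b - 2) * (\<Sum>c\<in>?K. \<Sum>d\<in>{c * b..<c * b + b}. (occ {\<alpha>..<\<beta>} (b ^ (N - Suc (Suc k))) d)\<^sup>2)
      \<le> ((real b)\<^sup>2 - 2) * (\<Sum>c\<in>?K. (occ {\<alpha>..<\<beta>} ?M c)\<^sup>2)"
      by (rule cell_ineq_two_partial[OF _ _ pq(1-3), where M = "real ?M"])
        (use pq(4) occ_interval_full_or_empty[OF M0] energy_block[OF finite_atLeastLessThan b0 k] in auto)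
  qed
  also have "\<dots> = ((real b)\<^sup>2 - 2) * energy {\<alpha>..<\<beta>} b N (Suc k)"
    unfolding energy_Suc sum_distrib_left ..
  finally show ?thesis .
qed

lemma energy_one_cell:
  assumes "0 < b" "k \<le> N" "\<alpha> < \<beta>" "\<beta> \<le> b ^ N" "\<alpha> div b ^ (N - k) = (\<beta> - 1) div b ^ (N - k)"
  shows "energy {\<alpha>..<\<beta>} b N k = (real (\<beta> - \<alpha>))\<^sup>2"
proof -
  let ?L = "b ^ (N - k)" and ?e = "\<alpha> div b ^ (N - k)"
  have e: "x div ?L = ?e" if "x \<in> {\<alpha>..<\<beta>}" for x
    using that assms(5) div_le_mono[of \<alpha> x ?L] div_le_mono[of x "\<beta> - 1" ?L] by fastforce
  have "b ^ N = ?L * b ^ k" using assms(2) by (simp flip: power_add)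
  then have "?e < b ^ k" using assms(3,4) by (simp add: less_mult_imp_div_less mult.commute)
  moreover have "occ {\<alpha>..<\<beta>} ?L c = (if c = ?e then real (\<beta> - \<alpha>) else 0)" for c
  proof -
    have "x div ?L = c \<longleftrightarrow> c = ?e" if "x \<in> {\<alpha>..<\<beta>}" for x
      using e[OF that] by metis
    then have "{x \<in> {\<alpha>..<\<beta>}. x div ?L = c} = {x \<in> {\<alpha>..<\<beta>}. c = ?e}"
      by (intro Collect_cong conj_cong refl)
    also have "\<dots> = (if c = ?e then {\<alpha>..<\<beta>} else {})" by auto
    finally have "{x \<in> {\<alpha>..<\<beta>}. x div ?L = c} = (if c = ?e then {\<alpha>..<\<beta>} else {})" .
    then show ?thesis unfolding occ_def by simp
  qed
  ultimately show ?thesis by (simp add: energy_def if_distrib[of "\<lambda>x. x\<^sup>2"] cong: if_cong)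
qed

text \<open>
  The weight at t is \<open>b ^ -t\<close> times the increment at t of the conditional probability
  \<open>b ^ Suc k * (C k - C (Suc k)) / (b - 1)\<close>; it telescopes, and the tail from m on is
  lumped at m, since only digits up to m matter for the net.
\<close>

definition tail_weight :: "nat \<Rightarrow> (nat \<Rightarrow> real) \<Rightarrow> nat \<Rightarrow> real" where
  "tail_weight b C k = (case k of 0 \<Rightarrow> C 0 | Suc l \<Rightarrow> (real b * C (Suc l) - C l) / (real b - 1))"

definition weight :: "nat \<Rightarrow> nat \<Rightarrow> (nat \<Rightarrow> real) \<Rightarrow> nat \<Rightarrow> real" where
  "weight b m C t = (if t < m then tail_weight b C t - tail_weight b C (Suc t) else tail_weight b C m)"

lemma sum_weight: "a \<le> m \<Longrightarrow> (\<Sum>t\<in>{a..m}. weight b m C t) = tail_weight b C a"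
proof -
  assume a: "a \<le> m"
  then have "{a..m} = insert m {a..<m}" by auto
  then have "(\<Sum>t\<in>{a..m}. weight b m C t) = tail_weight b C m + (\<Sum>t\<in>{a..<m}. tail_weight b C t - tail_weight b C (Suc t))"
    by (simp add: weight_def)
  also have "(\<Sum>t\<in>{a..<m}. tail_weight b C t - tail_weight b C (Suc t)) = tail_weight b C a - tail_weight b C m"
    using sum_Suc_diff'[OF a, of "\<lambda>t. - tail_weight b C t"] by simp
  finally show ?thesis by simp
qed

text \<open>Recovers the conditional probability for agreement in exactly k digits from its
  increments. \<open>k < m\<close> keeps the lumped last weight out of the sum.\<close>

lemma weighted_prefix_sum:
  assumes "2 \<le> b" "k < m"
  shows "(\<Sum>t\<le>k. real b ^ t * weight b m C t) = real b ^ Suc k * (C k - C (Suc k)) / (real b - 1)"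
  using assms(2)
proof (induction k)
  case 0
  then show ?case using assms(1) by (simp add: weight_def tail_weight_def field_simps)
next
  case (Suc k)
  then have "(\<Sum>t\<le>Suc k. real b ^ t * weight b m C t)
     = real b ^ Suc k * (C k - C (Suc k)) / (real b - 1) + real b ^ Suc k * weight b m C (Suc k)" by simp
  also have "weight b m C (Suc k) = (real b * (C (Suc k) - C (Suc (Suc k))) - (C k - C (Suc k))) / (real b - 1)"
    using Suc.prems by (simp add: weight_def tail_weight_def algebra_simps flip: diff_divide_distrib)
  finally show ?case by (simp add: algebra_simps flip: add_divide_distrib)
qed

text \<open>As long as one cell holds the whole interval, the energy is constant and the weights
  vanish. At the last such level \<open>k0\<close> the weight is nonnegative because energies
  decrease, and from \<open>k0 + 2\<close> on by concavity. Only the weight at \<open>k0 + 1\<close>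
  can be negative.\<close>

lemma interval_weight_mildly_signed:
  assumes b: "2 \<le> b" and m: "m \<le> N" and ab: "\<alpha> < \<beta>" "\<beta> \<le> b ^ N" and z: "0 \<le> z"
  shows "mildly_signed b m (weight b m (\<lambda>k. z * energy {\<alpha>..<\<beta>} b N k))"
proof -
  let ?one = "\<lambda>k. \<alpha> div b ^ (N - k) = (\<beta> - 1) div b ^ (N - k)"
  define C where "C k = z * energy {\<alpha>..<\<beta>} b N k" for k
  define T where "T = tail_weight b C"
  define h where "h = weight b m C"
  have b0: "0 < b" and b1: "0 < real b - 1" using b by auto
  have T_Suc: "(real b - 1) * T (Suc k) = real b * C (Suc k) - C k" for k
    using b by (simp add: T_def tail_weight_def)
  have T_0: "T 0 = C 0" by (simp add: T_def tail_weight_def)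
  have mono1: "C (Suc k) \<le> C k" if "k < m" for k
    unfolding C_def using z that m by (intro mult_left_mono energy_Suc_le) (use b0 in auto)
  have T_nonneg: "0 \<le> T k" if "k \<le> m" for k
  proof (cases k)
    case 0
    then show ?thesis using z by (simp add: T_0 C_def energy_def sum_nonneg)
  next
    case (Suc l)
    then have "energy {\<alpha>..<\<beta>} b N l \<le> real b * energy {\<alpha>..<\<beta>} b N (Suc l)"
      using that m by (intro energy_le_Suc) (use b0 in auto)
    then have "0 \<le> (real b - 1) * T k"
      using z unfolding Suc T_Suc C_def by (metis diff_ge_0_iff_ge mult.left_commute mult_left_mono)
    then show ?thesis using b1 by (simp add: zero_le_mult_iff)
  qed
  have one0: "?one 0" using ab by simp
  define k0 where "k0 = Max {k. k \<le> m \<and> ?one k}"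
  have fin: "finite {k. k \<le> m \<and> ?one k}" by simp
  have "k0 \<in> {k. k \<le> m \<and> ?one k}" unfolding k0_def by (rule Max_in[OF fin]) (use one0 in blast)
  then have k0: "k0 \<le> m" "?one k0" by auto
  have later: "\<not> ?one k" if "k0 < k" "k \<le> m" for k
  proof
    assume "?one k"
    then have "k \<le> k0" unfolding k0_def using that(2) by (intro Max_ge[OF fin]) blast
    then show False using that(1) by simp
  qed
  have earlier: "?one k" if "k \<le> k0" for k
  proof -
    have e: "b ^ (N - k) = b ^ (N - k0) * b ^ (k0 - k)" using that k0(1) m by (simp flip: power_add)
    show ?thesis unfolding e div_mult2_eq using k0(2) by simp
  qed
  define S where "S = z * (real (\<beta> - \<alpha>))\<^sup>2"
  have CS: "C k = S" if "k \<le> k0" for k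
    unfolding C_def S_def using energy_one_cell[OF b0 _ ab earlier[OF that]] that k0(1) m by simp
  have TS: "T k = S" if "k \<le> k0" for k
  proof (cases k)
    case (Suc l)
    then have "(real b - 1) * T k = (real b - 1) * S" using that CS T_Suc[of l] by (simp add: algebra_simps)
    then show ?thesis using b1 by simp
  qed (simp add: T_0 CS)
  have h: "h t = T t - T (Suc t)" if "t < m" for t using that by (simp add: h_def weight_def T_def)
  have hm: "h m = T m" by (simp add: h_def weight_def T_def)
  have h_late: "0 \<le> h t" if t: "k0 + 2 \<le> t" "t \<le> m" for t
  proof (cases "t = m")
    case False
    obtain k where k: "t = Suc k" using t by (cases t) auto
    have "energy {\<alpha>..<\<beta>} b N k + real b * energy {\<alpha>..<\<beta>} b N (Suc (Suc k))
      \<le> (real b + 1) * energy {\<alpha>..<\<beta>} b N (Suc k)"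
      by (rule energy_interval_concave[OF b _ ab(1)]) (use later[of k] t k False m in auto)
    from mult_left_mono[OF this z] have "C k + real b * C (Suc (Suc k)) \<le> (real b + 1) * C (Suc k)"
      by (simp add: C_def algebra_simps)
    then have "0 \<le> (real b - 1) * (T (Suc k) - T (Suc (Suc k)))"
      unfolding right_diff_distrib T_Suc by (simp add: algebra_simps)
    then show ?thesis using b1 h[of t] k t False by (simp add: zero_le_mult_iff)
  qed (simp add: hm T_nonneg)
  have h_k0: "0 \<le> h k0"
  proof (cases "k0 < m")
    case True
    have "(real b - 1) * (T k0 - T (Suc k0)) = real b * (C k0 - C (Suc k0))"
      unfolding right_diff_distrib T_Suc by (simp add: TS CS algebra_simps)
    also have "\<dots> \<ge> 0" using mono1[OF True] by simp
    finally show ?thesis using b1 h[OF True] by (simp add: zero_le_mult_iff)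
  qed (use k0 hm T_nonneg in auto)
  \<comment> \<open>The negative part of the weight at \<open>k0 + 1\<close>. If
    \<open>k0 + 2 > m\<close>, this entry is the lumped weight \<open>T m >= 0\<close> or lies out
    of range, and nothing has to be repaired.\<close>
  define D where "D = (if k0 + 2 \<le> m then max 0 (T (k0 + 2) - T (Suc k0)) else 0)"
  have D0: "0 \<le> D" by (simp add: D_def)
  have g: "0 \<le> h t + (if t = Suc k0 then D else 0)" if "t \<le> m" for t
  proof -
    have "t < k0 \<or> t = k0 \<or> t = Suc k0 \<and> Suc k0 < m \<or> t = Suc k0 \<and> Suc k0 = m \<or> k0 + 2 \<le> t"
      using that by linarith
    then consider "t < k0" | "t = k0" | "t = Suc k0" "Suc k0 < m" | "t = Suc k0" "Suc k0 = m" | "k0 + 2 \<le> t"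
      by blast
    then show ?thesis
    proof cases
      case 1
      then show ?thesis using h[of t] TS k0 by simp
    next
      case 3
      then show ?thesis using h[of t] by (simp add: D_def numeral_2_eq_2)
    next
      case 4
      then show ?thesis using hm T_nonneg[of m] D0 by simp
    qed (use h_k0 h_late that in auto)
  qed
  have bD: "real b * D \<le> h k0"
  proof (cases "k0 + 2 \<le> m")
    case True
    \<comment> \<open>Dropping the nonpositive difference \<open>C (k0 + 2) - C (k0 + 1)\<close>
      leaves exactly \<open>(b - 1) * h k0\<close>, because \<open>T k0 = C k0\<close> on the
      constant stretch.\<close>
    have "(real b - 1) * (real b * (T (Suc (Suc k0)) - T (Suc k0))) = real b * (real b * (C (Suc (Suc k0)) - C (Suc k0)) - (C (Suc k0) - C k0))"
    proof -
      have "(real b - 1) * (real b * (T (Suc (Suc k0)) - T (Suc k0)))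
          = real b * ((real b - 1) * T (Suc (Suc k0)) - (real b - 1) * T (Suc k0))"
        by (simp add: algebra_simps)
      then show ?thesis unfolding T_Suc by (simp add: algebra_simps)
    qed
    also have "\<dots> \<le> real b * (C k0 - C (Suc k0))"
      using mono1[of "Suc k0"] True by (intro mult_left_mono) (auto simp: mult_le_0_iff)
    also have "\<dots> = (real b - 1) * (T k0 - T (Suc k0))"
      unfolding right_diff_distrib T_Suc by (simp add: TS CS algebra_simps)
    also have "\<dots> = (real b - 1) * h k0" using h[of k0] True by simp
    finally have "real b * (T (Suc (Suc k0)) - T (Suc k0)) \<le> h k0" using b1 by simp
    then show ?thesis using h_k0 True by (simp add: D_def max_def numeral_2_eq_2)
  qed (simp add: D_def h_k0)
  have Dg: "(real b - 1) * D \<le> (\<Sum>t\<in>{k0 + 2..m}. h t)"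
  proof (cases "k0 + 2 \<le> m")
    case True
    have "(real b - 1) * energy {\<alpha>..<\<beta>} b N k0 + real b * (real b - 2) * energy {\<alpha>..<\<beta>} b N (Suc (Suc k0))
        \<le> ((real b)\<^sup>2 - 2) * energy {\<alpha>..<\<beta>} b N (Suc k0)"
      by (rule energy_interval_split_level[OF b]) (use True m in auto)
    from mult_left_mono[OF this z]
    have "(real b - 1) * C k0 + real b * (real b - 2) * C (Suc (Suc k0)) \<le> ((real b)\<^sup>2 - 2) * C (Suc k0)"
      by (simp add: C_def algebra_simps)
    then have "(real b - 2) * ((real b - 1) * T (Suc (Suc k0))) \<le> (real b - 1) * ((real b - 1) * T (Suc k0))"
      unfolding T_Suc by (simp add: algebra_simps power2_eq_square)
    then have "(real b - 1) * ((real b - 1) * (T (k0 + 2) - T (Suc k0))) \<le> (real b - 1) * T (k0 + 2)"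
      by (simp add: algebra_simps numeral_2_eq_2)
    then have "(real b - 1) * (T (k0 + 2) - T (Suc k0)) \<le> T (k0 + 2)" using b1 by simp
    then have "(real b - 1) * D \<le> T (k0 + 2)" using True T_nonneg by (simp add: D_def max_def)
    then show ?thesis using sum_weight[OF True, of b C] by (simp add: h_def T_def)
  qed (simp add: D_def)
  have "mildly_signed b m h"
    unfolding mildly_signed_def
    by (rule exI[of _ k0], rule exI[of _ D], rule exI[of _ "\<lambda>t. h t + (if t = Suc k0 then D else 0)"])
      (use D0 g k0(1) bD Dg in auto)
  moreover have "h = weight b m (\<lambda>k. z * energy {\<alpha>..<\<beta>} b N k)" by (simp add: h_def C_def[abs_def])
  ultimately show ?thesis by simp
qed

section \<open>Cylinder events of nested uniform permutations\<close>

text \<open>Composition with the transposition of x and d turns the requirement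
  \<open>p x = d\<close> into x being a fixed point.\<close>

lemma bij_betw_permutes_fixing:
  assumes "x \<in> S" "d \<in> S"
  shows "bij_betw (\<lambda>p. Transposition.transpose x d \<circ> p) {p. p permutes S \<and> p x = d} {q. q permutes S - {x}}"
proof (rule bij_betw_byWitness[where f' = "\<lambda>q. Transposition.transpose x d \<circ> q"])
  have S: "insert x (S - {x}) = S" using assms by auto
  show "(\<lambda>p. Transposition.transpose x d \<circ> p) ` {p. p permutes S \<and> p x = d} \<subseteq> {q. q permutes S - {x}}"
    using permutes_insert_lemma[of _ x "S - {x}"] unfolding S by auto
  show "(\<lambda>q. Transposition.transpose x d \<circ> q) ` {q. q permutes S - {x}} \<subseteq> {p. p permutes S \<and> p x = d}"
  proof clarify
    fix q assume q: "q permutes S - {x}"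
    then have "q permutes S" by (rule permutes_subset) auto
    moreover have "Transposition.transpose x d permutes S" using assms by (rule permutes_swap_id)
    moreover have "q x = x" using q by (simp add: permutes_not_in)
    ultimately show "Transposition.transpose x d \<circ> q permutes S \<and> (Transposition.transpose x d \<circ> q) x = d"
      by (simp add: permutes_compose)
  qed
qed (auto simp: fun_eq_iff)

lemma card_permutes_fixing:
  assumes "finite S" "x \<in> S" "d \<in> S"
  shows "card {p. p permutes S \<and> p x = d} = fact (card S - 1)"
proof -
  have "card {p. p permutes S \<and> p x = d} = card {q. q permutes S - {x}}"
    using bij_betw_same_card[OF bij_betw_permutes_fixing[OF assms(2,3)]] .
  then show ?thesis using assms by (simp add: card_permutations)
qed

lemma card_permutes_fixing_two:
  assumes "finite S" "x \<in> S" "d \<in> S" "y \<in> S" "e \<in> S" "x \<noteq> y" "d \<noteq> e"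
  shows "card {p. p permutes S \<and> p x = d \<and> p y = e} = fact (card S - 2)"
proof -
  have "bij_betw (\<lambda>p. Transposition.transpose x d \<circ> p) {p. p permutes S \<and> p x = d \<and> p y = e}
     {q. q permutes S - {x} \<and> q y = Transposition.transpose x d e}"
  proof (rule bij_betw_subset[OF bij_betw_permutes_fixing[OF assms(2,3)]])
    let ?f = "\<lambda>p. Transposition.transpose x d \<circ> p"
    have im: "?f ` {p. p permutes S \<and> p x = d} = {q. q permutes S - {x}}"
      using bij_betw_permutes_fixing[OF assms(2,3)] by (simp add: bij_betw_def)
    show "?f ` {p. p permutes S \<and> p x = d \<and> p y = e} = {q. q permutes S - {x} \<and> q y = Transposition.transpose x d e}"
    proof (intro set_eqI iffI)
      fix q assume "q \<in> ?f ` {p. p permutes S \<and> p x = d \<and> p y = e}"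
      then show "q \<in> {q. q permutes S - {x} \<and> q y = Transposition.transpose x d e}" using im by auto
    next
      fix q assume q: "q \<in> {q. q permutes S - {x} \<and> q y = Transposition.transpose x d e}"
      then obtain p where p: "p permutes S" "p x = d" "q = ?f p" using im by blast
      then have "Transposition.transpose x d (p y) = Transposition.transpose x d e" using q by simp
      then have "p y = e" by (metis transpose_involutory)
      then show "q \<in> ?f ` {p. p permutes S \<and> p x = d \<and> p y = e}" using p by blast
    qed
  qed auto
  then have "card {p. p permutes S \<and> p x = d \<and> p y = e} = card {q. q permutes S - {x} \<and> q y = Transposition.transpose x d e}"
    by (rule bij_betw_same_card)
  moreover have "Transposition.transpose x d e \<in> S - {x}" using assms by (auto simp: Transposition.transpose_def)
  ultimately show ?thesis using assms by (simp add: card_permutes_fixing diff_diff_add numeral_2_eq_2)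
qed

lemma finite_perms: "finite (perms b)" and card_perms: "card (perms b) = fact b"
  unfolding perms_def by (auto simp: finite_permutations card_permutations)

lemma perms_fraction_one:
  assumes "x < b" "d < b"
  shows "real (card {p \<in> perms b. p x = d}) / real (card (perms b)) = 1 / real b"
proof -
  have b: "(fact b :: real) = real b * fact (b - 1)" using assms by (intro fact_reduce) simp
  have "card {p \<in> perms b. p x = d} = fact (b - 1)"
    using card_permutes_fixing[of "{..<b}" x d] assms by (simp add: perms_def)
  then show ?thesis unfolding card_perms of_nat_fact b by simp
qed

lemma perms_fraction_two:
  assumes "x < b" "d < b" "y < b" "e < b" "x \<noteq> y"
  shows "real (card {p \<in> perms b. p x = d \<and> p y = e}) / real (card (perms b))
    = (if d = e then 0 else 1 / (real b * (real b - 1)))"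
proof (cases "d = e")
  case True
  have "{p \<in> perms b. p x = d \<and> p y = e} = {}"
    using assms(5) True by (auto simp: perms_def dest: permutes_inj injD)
  then have "card {p \<in> perms b. p x = d \<and> p y = e} = 0" by (simp only: card.empty)
  then show ?thesis using True by simp
next
  case False
  obtain a where a: "b = Suc (Suc a)" using assms by (metis Suc_lessI less_Suc0 not0_implies_Suc not_less0)
  have b: "(fact b :: real) = real b * (real b - 1) * fact (b - 2)"
    by (simp add: a algebra_simps)
  have "card {p \<in> perms b. p x = d \<and> p y = e} = fact (b - 2)"
    using card_permutes_fixing_two[of "{..<b}" x d y e] assms False by (simp add: perms_def)
  then show ?thesis unfolding card_perms of_nat_fact b using False by simp
qed

section \<open>Joint law of the leading scrambled digits of two points\<close>

locale scrambling = prob_space M for M :: "'w measure" +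
  fixes b :: nat and \<pi> :: "'s::finite \<Rightarrow> nat list \<Rightarrow> 'w \<Rightarrow> nat \<Rightarrow> nat"
  assumes b2: "2 \<le> b" and nested: "nested_uniform_perms M b \<pi>"
begin

text \<open>The index pair is independent of exactly this sigma-algebra, so events about scrambled
  digits must be shown to belong to it and not just to be measurable.\<close>

definition perm_algebra :: "'w measure" where
  "perm_algebra = vimage_algebra (space M) (\<lambda>\<omega>. \<lambda>(j, ds) \<in> perm_index b. \<pi> j ds \<omega>)
     (PiM (perm_index b) (\<lambda>_. count_space (perms b)))"

lemma random_perm: "k \<in> perm_index b \<Longrightarrow> (\<lambda>(j, ds). \<pi> j ds) k \<in> measurable M (count_space (perms b))"
  using nested by (auto simp: nested_uniform_perms_def indep_vars_def2)

lemma random_perm_permutes: "ds \<in> lists {..<b} \<Longrightarrow> \<omega> \<in> space M \<Longrightarrow> \<pi> j ds \<omega> permutes {..<b}"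
  using measurable_space[OF random_perm[of "(j, ds)"]] by (auto simp: perm_index_def perms_def)

lemma cylinder_prob:
  assumes "finite K" "K \<subseteq> perm_index b" "\<And>k. k \<in> K \<Longrightarrow> E k \<subseteq> perms b"
  shows "prob {\<omega> \<in> space M. \<forall>(j, ds) \<in> K. \<pi> j ds \<omega> \<in> E (j, ds)} = (\<Prod>k\<in>K. real (card (E k)) / real (card (perms b)))"
proof (cases "K = {}")
  case True
  then show ?thesis by (simp add: prob_space)
next
  case False
  let ?X = "\<lambda>(j, ds). \<pi> j ds"
  have "{\<omega> \<in> space M. \<forall>(j, ds) \<in> K. \<pi> j ds \<omega> \<in> E (j, ds)} = (\<Inter>k\<in>K. ?X k -` E k \<inter> space M)"
    using False by auto
  also have "prob \<dots> = (\<Prod>k\<in>K. prob (?X k -` E k \<inter> space M))"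
    using nested assms(3) by (intro indep_varsD[OF _ False assms(1,2)]) (auto simp: nested_uniform_perms_def)
  also have "\<dots> = (\<Prod>k\<in>K. real (card (E k)) / real (card (perms b)))"
  proof (rule prod.cong[OF refl])
    fix k assume k: "k \<in> K"
    obtain j ds where jd: "k = (j, ds)" by (cases k)
    have "prob (?X k -` E k \<inter> space M) = measure (distr M (count_space (perms b)) (?X k)) (E k)"
      using random_perm[of k] k assms by (subst measure_distr) auto
    also have "distr M (count_space (perms b)) (?X k) = uniform_count_measure (perms b)"
      using nested k assms(2) jd by (auto simp: nested_uniform_perms_def)
    also have "measure \<dots> (E k) = real (card (E k)) / real (card (perms b))"
      using k assms(3) by (simp add: measure_uniform_count_measure finite_perms)
    finally show "prob (?X k -` E k \<inter> space M) = real (card (E k)) / real (card (perms b))" .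
  qed
  finally show ?thesis .
qed

lemma cylinder_in_perm_algebra:
  assumes "finite K" "K \<subseteq> perm_index b" "\<And>k. k \<in> K \<Longrightarrow> E k \<subseteq> perms b"
  shows "{\<omega> \<in> space M. \<forall>(j, ds) \<in> K. \<pi> j ds \<omega> \<in> E (j, ds)} \<in> sets perm_algebra"
proof -
  let ?P = "PiM (perm_index b :: ('s \<times> nat list) set) (\<lambda>_. count_space (perms b))"
  let ?X = "\<lambda>\<omega>. \<lambda>(j, ds) \<in> perm_index b. \<pi> j ds \<omega>"
  have X: "?X \<omega> \<in> space ?P" if "\<omega> \<in> space M" for \<omega>
    using measurable_space[OF random_perm that] by (auto simp: space_PiM PiE_iff)
  have "{f \<in> space ?P. \<forall>k\<in>K. f k \<in> E k} \<in> sets ?P"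
  proof (rule sets.sets_Collect_finite_All[OF _ assms(1)])
    fix k assume k: "k \<in> K"
    have "(\<lambda>f. f k) \<in> measurable ?P (count_space (perms b))"
      using k assms(2) by (intro measurable_component_singleton) auto
    from measurable_sets[OF this, of "E k"] show "{f \<in> space ?P. f k \<in> E k} \<in> sets ?P"
      using assms(3)[OF k] by (simp add: vimage_def Int_def conj_commute)
  qed
  then have "?X -` {f \<in> space ?P. \<forall>k\<in>K. f k \<in> E k} \<inter> space M \<in> sets perm_algebra"
    unfolding perm_algebra_def by (rule in_vimage_algebra)
  also have "?X -` {f \<in> space ?P. \<forall>k\<in>K. f k \<in> E k} \<inter> space M
      = {\<omega> \<in> space M. \<forall>(j, ds) \<in> K. \<pi> j ds \<omega> \<in> E (j, ds)}"
    using X assms(2) by (auto simp: subset_iff)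
  finally show ?thesis .
qed

text \<open>Positions count from 0: \<open>\<xi> j i\<close> stands for digit \<open>Suc i\<close>
  of coordinate j.\<close>

definition scrambled_digit :: "('s \<Rightarrow> nat \<Rightarrow> nat) \<Rightarrow> 's \<Rightarrow> nat \<Rightarrow> 'w \<Rightarrow> nat" where
  "scrambled_digit \<xi> j i \<omega> = \<pi> j (map (\<xi> j) [0..<i]) \<omega> (\<xi> j i)"

definition digit_atom :: "nat \<Rightarrow> ('s \<Rightarrow> nat \<Rightarrow> nat) \<Rightarrow> ('s \<Rightarrow> nat \<Rightarrow> nat) \<Rightarrow> ('s \<Rightarrow> nat \<Rightarrow> nat) \<Rightarrow> ('s \<Rightarrow> nat \<Rightarrow> nat) \<Rightarrow> 'w set" where
  "digit_atom N \<xi> \<eta> c c' = {\<omega> \<in> space M. \<forall>j. \<forall>i<N. scrambled_digit \<xi> j i \<omega> = c j i \<and> scrambled_digit \<eta> j i \<omega> = c' j i}"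

definition prefixes :: "nat \<Rightarrow> ('s \<Rightarrow> nat \<Rightarrow> nat) \<Rightarrow> ('s \<Rightarrow> nat \<Rightarrow> nat) \<Rightarrow> ('s \<times> nat list) set" where
  "prefixes N \<xi> \<eta> = Sigma UNIV (\<lambda>j. \<Union>i<N. {map (\<xi> j) [0..<i], map (\<eta> j) [0..<i]})"

text \<open>A string constrains its permutation only at the position given by its length. The two
  comparisons test whether the string is a prefix of \<open>\<xi>\<close>, of \<open>\<eta>\<close>
  or of both; a common prefix puts both requirements on one permutation.\<close>

definition atom_perms :: "('s \<Rightarrow> nat \<Rightarrow> nat) \<Rightarrow> ('s \<Rightarrow> nat \<Rightarrow> nat) \<Rightarrow> ('s \<Rightarrow> nat \<Rightarrow> nat) \<Rightarrow> ('s \<Rightarrow> nat \<Rightarrow> nat) \<Rightarrow> 's \<times> nat list \<Rightarrow> (nat \<Rightarrow> nat) set" where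
  "atom_perms \<xi> \<eta> c c' = (\<lambda>(j, ds). {p \<in> perms b.
     (ds = map (\<xi> j) [0..<length ds] \<longrightarrow> p (\<xi> j (length ds)) = c j (length ds)) \<and>
     (ds = map (\<eta> j) [0..<length ds] \<longrightarrow> p (\<eta> j (length ds)) = c' j (length ds))})"

lemma digit_atom_cylinder:
  assumes "\<And>j i. \<xi> j i < b" "\<And>j i. \<eta> j i < b"
  shows "digit_atom N \<xi> \<eta> c c' = {\<omega> \<in> space M. \<forall>(j, ds) \<in> prefixes N \<xi> \<eta>. \<pi> j ds \<omega> \<in> atom_perms \<xi> \<eta> c c' (j, ds)}"
    and "prefixes N \<xi> \<eta> \<subseteq> perm_index b" and "finite (prefixes N \<xi> \<eta>)"
proof -
  show "finite (prefixes N \<xi> \<eta>)" unfolding prefixes_def by (intro finite_SigmaI) auto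
  show "prefixes N \<xi> \<eta> \<subseteq> perm_index b"
    using assms by (auto simp: prefixes_def perm_index_def)
  then have perm: "\<pi> j ds \<omega> \<in> perms b" if "\<omega> \<in> space M" "(j, ds) \<in> prefixes N \<xi> \<eta>" for \<omega> j ds
    using random_perm_permutes that by (auto simp: perm_index_def perms_def subset_iff)
  show "digit_atom N \<xi> \<eta> c c' = {\<omega> \<in> space M. \<forall>(j, ds) \<in> prefixes N \<xi> \<eta>. \<pi> j ds \<omega> \<in> atom_perms \<xi> \<eta> c c' (j, ds)}"
  proof (intro set_eqI iffI)
    fix \<omega> assume \<omega>: "\<omega> \<in> digit_atom N \<xi> \<eta> c c'"
    show "\<omega> \<in> {\<omega> \<in> space M. \<forall>(j, ds) \<in> prefixes N \<xi> \<eta>. \<pi> j ds \<omega> \<in> atom_perms \<xi> \<eta> c c' (j, ds)}"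
    proof clarify
      have sp: "\<omega> \<in> space M" using \<omega> by (simp add: digit_atom_def)
      have "\<pi> j ds \<omega> \<in> atom_perms \<xi> \<eta> c c' (j, ds)" if jd: "(j, ds) \<in> prefixes N \<xi> \<eta>" for j ds
      proof -
        have len: "length ds < N" using jd by (auto simp: prefixes_def)
        have "\<pi> j (map (\<xi> j) [0..<length ds]) \<omega> (\<xi> j (length ds)) = c j (length ds)"
          "\<pi> j (map (\<eta> j) [0..<length ds]) \<omega> (\<eta> j (length ds)) = c' j (length ds)"
          using \<omega> len by (auto simp: digit_atom_def scrambled_digit_def)
        then show ?thesis using perm[OF sp jd] unfolding atom_perms_def
          by (simp only: prod.case mem_Collect_eq) metis
      qed
      then show "\<omega> \<in> space M \<and> (\<forall>(j, ds) \<in> prefixes N \<xi> \<eta>. \<pi> j ds \<omega> \<in> atom_perms \<xi> \<eta> c c' (j, ds))"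
        using sp by blast
    qed
  next
    fix \<omega> assume "\<omega> \<in> {\<omega> \<in> space M. \<forall>(j, ds) \<in> prefixes N \<xi> \<eta>. \<pi> j ds \<omega> \<in> atom_perms \<xi> \<eta> c c' (j, ds)}"
    then have sp: "\<omega> \<in> space M"
      and *: "\<And>j ds. (j, ds) \<in> prefixes N \<xi> \<eta> \<Longrightarrow> \<pi> j ds \<omega> \<in> atom_perms \<xi> \<eta> c c' (j, ds)" by auto
    show "\<omega> \<in> digit_atom N \<xi> \<eta> c c'"
      unfolding digit_atom_def scrambled_digit_def
    proof (intro CollectI conjI allI impI sp)
      fix j i assume i: "i < N"
      have m: "(j, map (\<xi> j) [0..<i]) \<in> prefixes N \<xi> \<eta>" "(j, map (\<eta> j) [0..<i]) \<in> prefixes N \<xi> \<eta>"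
        using i by (auto simp: prefixes_def)
      show "\<pi> j (map (\<xi> j) [0..<i]) \<omega> (\<xi> j i) = c j i"
        using *[OF m(1)] by (simp add: atom_perms_def)
      show "\<pi> j (map (\<eta> j) [0..<i]) \<omega> (\<eta> j i) = c' j i"
        using *[OF m(2)] by (simp add: atom_perms_def)
    qed
  qed
qed

lemma digit_atom_in_perm_algebra:
  assumes "\<And>j i. \<xi> j i < b" "\<And>j i. \<eta> j i < b"
  shows "digit_atom N \<xi> \<eta> c c' \<in> sets perm_algebra"
  unfolding digit_atom_cylinder(1)[OF assms]
  by (rule cylinder_in_perm_algebra[OF digit_atom_cylinder(3,2)]) (use assms in \<open>auto simp: atom_perms_def\<close>)

text \<open>Before the digits diverge, one permutation acts on one digit, with probability 1 / b. At
  the divergence one permutation acts on two distinct digits, which leaves b * (b - 1) equally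
  likely pairs of distinct images. Afterwards the prefixes differ and two independent permutations
  act.\<close>

lemma digit_atom_prob:
  assumes \<xi>: "\<And>j i. \<xi> j i < b" and \<eta>: "\<And>j i. \<eta> j i < b"
    and c: "\<And>j i. c j i < b" and c': "\<And>j i. c' j i < b"
    and \<gamma>: "\<And>j i. i < \<gamma> j \<Longrightarrow> \<xi> j i = \<eta> j i" "\<And>j. \<xi> j (\<gamma> j) \<noteq> \<eta> j (\<gamma> j)"
  shows "prob (digit_atom N \<xi> \<eta> c c') = (\<Prod>j\<in>UNIV. \<Prod>i<N.
     if i < \<gamma> j then (if c j i = c' j i then 1 / real b else 0)
     else if i = \<gamma> j then (if c j i = c' j i then 0 else 1 / (real b * (real b - 1)))
     else 1 / (real b)\<^sup>2)"
proof -
  let ?E = "\<lambda>k. real (card (atom_perms \<xi> \<eta> c c' k)) / real (card (perms b))"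
  have "prob (digit_atom N \<xi> \<eta> c c') = (\<Prod>k\<in>prefixes N \<xi> \<eta>. ?E k)"
    unfolding digit_atom_cylinder(1)[OF \<xi> \<eta>]
    by (rule cylinder_prob[OF digit_atom_cylinder(3,2)]) (use \<xi> \<eta> in \<open>auto simp: atom_perms_def\<close>)
  also have "\<dots> = (\<Prod>j\<in>UNIV. \<Prod>ds\<in>(\<Union>i<N. {map (\<xi> j) [0..<i], map (\<eta> j) [0..<i]}). ?E (j, ds))"
    unfolding prefixes_def by (subst prod.Sigma) auto
  also have "\<dots> = (\<Prod>j\<in>UNIV. \<Prod>i<N. \<Prod>ds\<in>{map (\<xi> j) [0..<i], map (\<eta> j) [0..<i]}. ?E (j, ds))"
  proof (rule prod.cong[OF refl], rule prod.UNION_disjoint)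
    show "\<forall>i\<in>{..<N}. \<forall>l\<in>{..<N}. i \<noteq> l \<longrightarrow>
      {map (\<xi> j) [0..<i], map (\<eta> j) [0..<i]} \<inter> {map (\<xi> j) [0..<l], map (\<eta> j) [0..<l]} = {}" for j
      by (auto dest!: map_eq_imp_length_eq)
  qed auto
  also have "\<dots> = (\<Prod>j\<in>UNIV. \<Prod>i<N.
     if i < \<gamma> j then (if c j i = c' j i then 1 / real b else 0)
     else if i = \<gamma> j then (if c j i = c' j i then 0 else 1 / (real b * (real b - 1)))
     else 1 / (real b)\<^sup>2)"
  proof (intro prod.cong refl)
    fix j i
    show "(\<Prod>ds\<in>{map (\<xi> j) [0..<i], map (\<eta> j) [0..<i]}. ?E (j, ds)) =
      (if i < \<gamma> j then (if c j i = c' j i then 1 / real b else 0)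
     else if i = \<gamma> j then (if c j i = c' j i then 0 else 1 / (real b * (real b - 1)))
     else 1 / (real b)\<^sup>2)"
    proof (cases "i \<le> \<gamma> j")
      case True
      then have eq: "map (\<xi> j) [0..<i] = map (\<eta> j) [0..<i]" using \<gamma>(1)[of _ j] by simp
      have "atom_perms \<xi> \<eta> c c' (j, map (\<eta> j) [0..<i]) = {p \<in> perms b. p (\<xi> j i) = c j i \<and> p (\<eta> j i) = c' j i}"
        by (simp add: atom_perms_def eq del: map_eq_conv)
      then have "(\<Prod>ds\<in>{map (\<xi> j) [0..<i], map (\<eta> j) [0..<i]}. ?E (j, ds))
         = real (card {p \<in> perms b. p (\<xi> j i) = c j i \<and> p (\<eta> j i) = c' j i}) / real (card (perms b))"
        unfolding eq by simp
      moreover have "\<dots> = (if c j i = c' j i then 1 / real b else 0)" if "i < \<gamma> j"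
      proof (cases "c j i = c' j i")
        case True
        then have "{p \<in> perms b. p (\<xi> j i) = c j i \<and> p (\<eta> j i) = c' j i} = {p \<in> perms b. p (\<xi> j i) = c j i}"
          using \<gamma>(1)[OF that] by auto
        then show ?thesis using True perms_fraction_one[OF \<xi> c, of j i j i] by simp
      next
        case False
        then have "{p \<in> perms b. p (\<xi> j i) = c j i \<and> p (\<eta> j i) = c' j i} = {}"
          using \<gamma>(1)[OF that] by auto
        then have "card {p \<in> perms b. p (\<xi> j i) = c j i \<and> p (\<eta> j i) = c' j i} = 0" by (simp only: card.empty)
        then show ?thesis using False by simp
      qed
      moreover have "real (card {p \<in> perms b. p (\<xi> j i) = c j i \<and> p (\<eta> j i) = c' j i}) / real (card (perms b))
          = (if c j i = c' j i then 0 else 1 / (real b * (real b - 1)))" if "i = \<gamma> j"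
        using perms_fraction_two[OF \<xi> c \<eta> c', of j i j i j i j i] \<gamma>(2)[of j] that by simp
      ultimately show ?thesis using True by auto
    next
      case False
      then have ne: "map (\<xi> j) [0..<i] \<noteq> map (\<eta> j) [0..<i]" using \<gamma>(2)[of j] by auto
      have "?E (j, map (\<xi> j) [0..<i]) = 1 / real b" "?E (j, map (\<eta> j) [0..<i]) = 1 / real b"
        using perms_fraction_one[OF \<xi>[of j i] c[of j i]] perms_fraction_one[OF \<eta>[of j i] c'[of j i]] ne ne[symmetric]
        by (simp_all add: atom_perms_def del: map_eq_conv)
      then show ?thesis using ne False by (simp add: power2_eq_square del: map_eq_conv)
    qed
  qed
  finally show ?thesis .
qed

end

section \<open>Cells of scrambled digits\<close>

text \<open>The index of the level-k cell whose base-b digits are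
  \<open>d 0, ..., d (k - 1)\<close>, most significant first.\<close>

primrec horner :: "nat \<Rightarrow> (nat \<Rightarrow> nat) \<Rightarrow> nat \<Rightarrow> nat" where
  "horner b d 0 = 0"
| "horner b d (Suc k) = b * horner b d k + d k"

text \<open>Position 0 is the most significant of N digits, in step with
  \<open>horner\<close>.\<close>

definition place :: "nat \<Rightarrow> nat \<Rightarrow> nat \<Rightarrow> nat \<Rightarrow> nat" where
  "place b N c i = c div b ^ (N - Suc i) mod b"

lemma horner_div:
  assumes "\<And>i. d i < b"
  shows "horner b d (k + r) div b ^ r = horner b d k"
proof (induction r)
  case (Suc r)
  have "horner b d (k + Suc r) div b ^ Suc r = (b * horner b d (k + r) + d (k + r)) div b div b ^ r"
    by (simp add: div_mult2_eq)
  also have "(b * horner b d (k + r) + d (k + r)) div b = horner b d (k + r)"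
    using assms[of "k + r"] by simp
  finally show ?case using Suc by simp
qed simp

lemma place_horner:
  assumes "\<And>i. d i < b" "i < N"
  shows "place b N (horner b d N) i = d i"
proof -
  have "horner b d N div b ^ (N - Suc i) = horner b d (Suc i)"
    using horner_div[of d b "Suc i" "N - Suc i"] assms by simp
  then show ?thesis using assms by (simp add: place_def)
qed

lemma div_eq_of_places:
  assumes "\<And>i. i < k \<Longrightarrow> place b N c i = place b N c' i" "k \<le> N" "c < b ^ N" "c' < b ^ N"
  shows "c div b ^ (N - k) = c' div b ^ (N - k)"
  using assms(1,2)
proof (induction k)
  case 0
  then show ?case using assms by simp
next
  case (Suc k)
  have e: "x div b ^ (N - Suc k) = (x div b ^ (N - k)) * b + place b N x k" for x
  proof -
    have "b ^ (N - k) = b ^ (N - Suc k) * b" using power_diff_step[of k N b] Suc.prems by (simp add: mult.commute)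
    then have "x div b ^ (N - k) = x div b ^ (N - Suc k) div b" by (simp add: div_mult2_eq)
    then show ?thesis by (simp add: place_def)
  qed
  show ?case unfolding e using Suc by simp
qed

section \<open>Energies as numbers of pairs of cells\<close>

lemma energy_eq_card_pairs:
  assumes "finite J" "J \<subseteq> {..<b ^ N}" "k \<le> N"
  shows "energy J b N k = real (card {(c, c') \<in> J \<times> J. c div b ^ (N - k) = c' div b ^ (N - k)})"
proof -
  let ?L = "b ^ (N - k)"
  let ?A = "\<lambda>e. {x \<in> J. x div ?L = e}"
  have "x div ?L < b ^ k" if "x \<in> J" for x
  proof -
    have "b ^ N = b ^ k * ?L" using assms(3) by (simp flip: power_add)
    then show ?thesis using that assms(2) by (auto intro!: less_mult_imp_div_less)
  qed
  then have eq: "{(c, c') \<in> J \<times> J. c div ?L = c' div ?L} = (\<Union>e<b ^ k. ?A e \<times> ?A e)"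
    by auto
  have "card (\<Union>e<b ^ k. ?A e \<times> ?A e) = (\<Sum>e<b ^ k. card (?A e \<times> ?A e))"
    using assms(1) by (intro card_UN_disjoint) auto
  also have "\<dots> = (\<Sum>e<b ^ k. (card (?A e))\<^sup>2)"
    by (simp only: card_cartesian_product power2_eq_square)
  finally show ?thesis
    unfolding eq energy_def occ_def by (simp only: of_nat_sum of_nat_power)
qed

lemma energy_diff_eq_card_pairs:
  assumes "finite J" "J \<subseteq> {..<b ^ N}" "k < N"
  shows "energy J b N k - energy J b N (Suc k) = real (card {(c, c') \<in> J \<times> J.
     c div b ^ (N - k) = c' div b ^ (N - k) \<and> c div b ^ (N - Suc k) \<noteq> c' div b ^ (N - Suc k)})"
proof -
  let ?P = "\<lambda>k. {(c, c') \<in> J \<times> J. c div b ^ (N - k) = c' div b ^ (N - k)}"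
  have sub: "?P (Suc k) \<subseteq> ?P k"
  proof -
    have "x div b ^ (N - k) = x div b ^ (N - Suc k) div b" for x
      using power_diff_step[OF assms(3), of b] by (metis div_mult2_eq mult.commute)
    then show ?thesis by auto
  qed
  have fin: "finite (?P k)" by (rule finite_subset[of _ "J \<times> J"]) (use assms(1) in auto)
  have eq: "{(c, c') \<in> J \<times> J. c div b ^ (N - k) = c' div b ^ (N - k) \<and> c div b ^ (N - Suc k) \<noteq> c' div b ^ (N - Suc k)}
     = ?P k - ?P (Suc k)" by blast
  have "real (card (?P k - ?P (Suc k))) = real (card (?P k)) - real (card (?P (Suc k)))"
    using card_Diff_subset[OF finite_subset[OF sub fin] sub] card_mono[OF fin sub] by simp
  then show ?thesis
    unfolding eq energy_eq_card_pairs[OF assms(1,2) less_imp_le[OF assms(3)]]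
      energy_eq_card_pairs[OF assms(1,2) Suc_leI[OF assms(3)]] by (rule sym)
qed

text \<open>The positions before, at and after \<open>\<gamma>\<close> contribute
  \<open>b ^ -\<gamma>\<close>, \<open>1 / (b * (b - 1))\<close> and
  \<open>b ^ (-2 * (N - \<gamma> - 1))\<close>. Their product depends on the cells only through
  where these first differ, so summing over cells reduces to counting pairs.\<close>

lemma prod_atom_factors:
  fixes b N \<gamma> :: nat
  assumes "2 \<le> b" "\<gamma> < N"
  shows "(\<Prod>i<N. if i < \<gamma> then (if c i = c' i then 1 / real b else 0)
     else if i = \<gamma> then (if c i = c' i then 0 else 1 / (real b * (real b - 1)))
     else 1 / (real b)\<^sup>2)
   = (if (\<forall>i<\<gamma>. c i = c' i) \<and> c \<gamma> \<noteq> c' \<gamma> then real b ^ Suc \<gamma> / ((real b - 1) * (real b ^ N)\<^sup>2) else 0)"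
    (is "(\<Prod>i<N. ?r i) = (if ?C then ?v else 0)")
proof (cases ?C)
  case True
  have split: "prod r {..<N} = prod r {..<\<gamma>} * (prod r {\<gamma>} * prod r {\<gamma><..<N})" for r :: "nat \<Rightarrow> real"
  proof -
    have "prod r {..<N} = prod r {..<\<gamma>} * prod r {\<gamma>..<N}"
      using assms(2) prod.atLeastLessThan_concat[of 0 \<gamma> N r] by (simp add: atLeast0LessThan)
    also have "{\<gamma>..<N} = insert \<gamma> {\<gamma><..<N}" using assms(2) by auto
    finally show ?thesis by simp
  qed
  have low: "(\<Prod>i<\<gamma>. ?r i) = 1 / real b ^ \<gamma>"
  proof -
    have "(\<Prod>i<\<gamma>. ?r i) = (\<Prod>i<\<gamma>. 1 / real b)" by (rule prod.cong[OF refl]) (use True in simp)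
    then show ?thesis by (simp add: power_divide)
  qed
  have mid: "(\<Prod>i\<in>{\<gamma>}. ?r i) = 1 / (real b * (real b - 1))" using True by simp
  have high: "(\<Prod>i\<in>{\<gamma><..<N}. ?r i) = 1 / (real b ^ (N - Suc \<gamma>))\<^sup>2"
  proof -
    have "(\<Prod>i\<in>{\<gamma><..<N}. ?r i) = (\<Prod>i\<in>{\<gamma><..<N}. 1 / (real b)\<^sup>2)" by (rule prod.cong[OF refl]) simp
    then show ?thesis by (simp add: power_divide power_mult[symmetric] mult.commute)
  qed
  have alg: "1 / P * (1 / (B * (B - 1)) * (1 / Q\<^sup>2)) = B * P / ((B - 1) * (B * P * Q)\<^sup>2)"
    if "P \<noteq> 0" "B \<noteq> 0" "Q \<noteq> 0" for P B Q :: real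
    using that by (simp add: power2_eq_square)
  have N: "real b ^ N = real b * real b ^ \<gamma> * real b ^ (N - Suc \<gamma>)"
    using assms(2) power_add[of "real b" "Suc \<gamma>" "N - Suc \<gamma>"] by simp
  have "(\<Prod>i<N. ?r i) = 1 / real b ^ \<gamma> * (1 / (real b * (real b - 1)) * (1 / (real b ^ (N - Suc \<gamma>))\<^sup>2))"
    by (subst split) (simp only: low mid high)
  then have "(\<Prod>i<N. ?r i) = ?v"
    unfolding N power_Suc using alg[of "real b ^ \<gamma>" "real b" "real b ^ (N - Suc \<gamma>)"] assms(1) by (simp only:) simp
  then show ?thesis by (simp only: if_P[OF True])
next
  case False
  have "\<exists>i\<in>{..<N}. ?r i = 0"
  proof (cases "c \<gamma> = c' \<gamma>")
    case True
    show ?thesis by (rule bexI[of _ \<gamma>]) (simp_all add: True assms(2))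
  next
    case ne: False
    then have "\<exists>i<\<gamma>. c i \<noteq> c' i" using False by simp
    then obtain i where i: "i < \<gamma>" "c i \<noteq> c' i" by (elim exE conjE)
    show ?thesis by (rule bexI[of _ i]) (use i assms(2) in simp_all)
  qed
  then have "(\<Prod>i<N. ?r i) = 0" by (rule prod_zero[OF finite_lessThan])
  then show ?thesis by (simp only: if_not_P[OF False])
qed

text \<open>For an upper bound it is enough that equal leading places force equal cells, so that
  every contributing pair is among those counted by the energy difference.\<close>

lemma sum_atom_factors:
  assumes b: "2 \<le> b" and \<gamma>: "\<gamma> < N" and J: "J \<subseteq> {..<b ^ N}"
  shows "(\<Sum>(c, c')\<in>J \<times> J. \<Prod>i<N. if i < \<gamma> then (if place b N c i = place b N c' i then 1 / real b else 0)
     else if i = \<gamma> then (if place b N c i = place b N c' i then 0 else 1 / (real b * (real b - 1)))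
     else 1 / (real b)\<^sup>2)
    \<le> real b ^ Suc \<gamma> * (1 / (real b ^ N)\<^sup>2 * energy J b N \<gamma> - 1 / (real b ^ N)\<^sup>2 * energy J b N (Suc \<gamma>)) / (real b - 1)"
proof -
  have fin: "finite J" using J finite_subset by blast
  let ?v = "real b ^ Suc \<gamma> / ((real b - 1) * (real b ^ N)\<^sup>2)"
  let ?D = "{(c, c') \<in> J \<times> J. c div b ^ (N - \<gamma>) = c' div b ^ (N - \<gamma>) \<and> c div b ^ (N - Suc \<gamma>) \<noteq> c' div b ^ (N - Suc \<gamma>)}"
  have "(\<Sum>(c, c')\<in>J \<times> J. if (\<forall>i<\<gamma>. place b N c i = place b N c' i) \<and> place b N c \<gamma> \<noteq> place b N c' \<gamma> then ?v else 0)
     \<le> (\<Sum>p\<in>J \<times> J. if p \<in> ?D then ?v else 0)"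
  proof (rule sum_mono)
    fix p assume p: "p \<in> J \<times> J"
    obtain c c' where cc: "p = (c, c')" by (cases p)
    have "p \<in> ?D" if "(\<forall>i<\<gamma>. place b N c i = place b N c' i) \<and> place b N c \<gamma> \<noteq> place b N c' \<gamma>"
      using that div_eq_of_places[of \<gamma> b N c c'] p cc J \<gamma> by (auto simp: place_def)
    then show "(case p of (c, c') \<Rightarrow> if (\<forall>i<\<gamma>. place b N c i = place b N c' i) \<and> place b N c \<gamma> \<noteq> place b N c' \<gamma> then ?v else 0)
       \<le> (if p \<in> ?D then ?v else 0)" using b by (auto simp: cc)
  qed
  also have "\<dots> = real (card ?D) * ?v"
  proof -
    have "?D \<subseteq> J \<times> J" by auto
    then show ?thesis using fin by (simp add: sum.If_cases Int_absorb1 del: mem_Collect_eq split_paired_All)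
  qed
  also have "real (card ?D) = energy J b N \<gamma> - energy J b N (Suc \<gamma>)"
    using energy_diff_eq_card_pairs[OF fin J \<gamma>] by simp
  finally show ?thesis unfolding prod_atom_factors[OF b \<gamma>]
    by (simp add: right_diff_distrib' left_diff_distrib' diff_divide_distrib mult.commute)
qed

context scrambling begin

text \<open>Indexing by functions into pairs of cells lets the sum over atoms factor into a product
  over coordinates.\<close>

definition cell_event :: "nat \<Rightarrow> ('s \<Rightarrow> nat \<Rightarrow> nat) \<Rightarrow> ('s \<Rightarrow> nat \<Rightarrow> nat) \<Rightarrow> ('s \<Rightarrow> nat set) \<Rightarrow> 'w set" where
  "cell_event N \<xi> \<eta> J = (\<Union>p\<in>PiE UNIV (\<lambda>j. J j \<times> J j).
     digit_atom N \<xi> \<eta> (\<lambda>j. place b N (fst (p j))) (\<lambda>j. place b N (snd (p j))))"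

lemma scrambled_digit_less:
  assumes "\<And>j i. \<xi> j i < b" "\<omega> \<in> space M"
  shows "scrambled_digit \<xi> j i \<omega> < b"
proof -
  have "map (\<xi> j) [0..<i] \<in> lists {..<b}" using assms(1) by auto
  from permutes_in_image[OF random_perm_permutes[OF this assms(2)], of j "\<xi> j i"] show ?thesis
    using assms(1) by (simp add: scrambled_digit_def)
qed

lemma cell_eventI:
  assumes "\<And>j i. \<xi> j i < b" "\<And>j i. \<eta> j i < b" "\<omega> \<in> space M"
    and "\<And>j. horner b (\<lambda>i. scrambled_digit \<xi> j i \<omega>) N \<in> J j" "\<And>j. horner b (\<lambda>i. scrambled_digit \<eta> j i \<omega>) N \<in> J j"
  shows "\<omega> \<in> cell_event N \<xi> \<eta> J"
proof -
  define p where "p j = (horner b (\<lambda>i. scrambled_digit \<xi> j i \<omega>) N, horner b (\<lambda>i. scrambled_digit \<eta> j i \<omega>) N)" for j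
  have "p \<in> PiE UNIV (\<lambda>j. J j \<times> J j)" using assms(4,5) by (auto simp: p_def)
  moreover have "\<omega> \<in> digit_atom N \<xi> \<eta> (\<lambda>j. place b N (fst (p j))) (\<lambda>j. place b N (snd (p j)))"
    using assms(3) by (simp add: digit_atom_def p_def place_horner scrambled_digit_less assms(1,2))
  ultimately show ?thesis unfolding cell_event_def by blast
qed

lemma cell_event_in_perm_algebra:
  assumes "\<And>j i. \<xi> j i < b" "\<And>j i. \<eta> j i < b" "\<And>j. finite (J j)"
  shows "cell_event N \<xi> \<eta> J \<in> sets perm_algebra"
  unfolding cell_event_def
  by (intro sets.finite_UN finite_PiE finite_cartesian_product assms digit_atom_in_perm_algebra) auto

lemma perm_algebra_subset: "sets perm_algebra \<subseteq> events"
proof -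
  have "(\<lambda>\<omega>. \<lambda>(j, ds) \<in> perm_index b. \<pi> j ds \<omega>) \<in> measurable M (PiM (perm_index b) (\<lambda>_. count_space (perms b)))"
    by (rule measurable_restrict[THEN measurable_cong[THEN iffD1, rotated]]) (use random_perm in auto)
  then show ?thesis unfolding perm_algebra_def by (rule sets_image_in_sets[rotated]) simp
qed

text \<open>A union bound over the atoms; since the probability of an atom is a product over
  coordinates, the sum over all choices of cells becomes a product of sums.\<close>

lemma cell_event_prob_le:
  assumes \<xi>: "\<And>j i. \<xi> j i < b" and \<eta>: "\<And>j i. \<eta> j i < b"
    and \<gamma>: "\<And>j i. i < \<gamma> j \<Longrightarrow> \<xi> j i = \<eta> j i" "\<And>j. \<xi> j (\<gamma> j) \<noteq> \<eta> j (\<gamma> j)" "\<And>j. \<gamma> j < N"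
    and J: "\<And>j. J j \<subseteq> {..<b ^ N}"
  shows "prob (cell_event N \<xi> \<eta> J) \<le> (\<Prod>j\<in>UNIV. real b ^ Suc (\<gamma> j) *
     (1 / (real b ^ N)\<^sup>2 * energy (J j) b N (\<gamma> j) - 1 / (real b ^ N)\<^sup>2 * energy (J j) b N (Suc (\<gamma> j))) / (real b - 1))"
proof -
  have fin: "finite (J j)" for j using J finite_subset by blast
  let ?r = "\<lambda>j c c'. \<Prod>i<N. if i < \<gamma> j then (if place b N c i = place b N c' i then 1 / real b else 0)
     else if i = \<gamma> j then (if place b N c i = place b N c' i then 0 else 1 / (real b * (real b - 1)))
     else 1 / (real b)\<^sup>2"
  have pl: "place b N c i < b" for c i using b2 by (simp add: place_def)
  have "prob (cell_event N \<xi> \<eta> J) \<le> (\<Sum>p\<in>PiE UNIV (\<lambda>j. J j \<times> J j).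
     prob (digit_atom N \<xi> \<eta> (\<lambda>j. place b N (fst (p j))) (\<lambda>j. place b N (snd (p j)))))"
    unfolding cell_event_def
    by (intro finite_measure_subadditive_finite finite_PiE)
      (use fin digit_atom_in_perm_algebra[OF \<xi> \<eta>] perm_algebra_subset in auto)
  also have "\<dots> = (\<Sum>p\<in>PiE UNIV (\<lambda>j. J j \<times> J j). \<Prod>j\<in>UNIV. case p j of (c, c') \<Rightarrow> ?r j c c')"
  proof (intro sum.cong refl)
    fix p :: "'s \<Rightarrow> nat \<times> nat"
    have "prob (digit_atom N \<xi> \<eta> (\<lambda>j. place b N (fst (p j))) (\<lambda>j. place b N (snd (p j))))
        = (\<Prod>j\<in>UNIV. ?r j (fst (p j)) (snd (p j)))"
      by (rule digit_atom_prob[where \<gamma> = \<gamma>]) (use \<xi> \<eta> pl \<gamma> in auto)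
    then show "prob (digit_atom N \<xi> \<eta> (\<lambda>j. place b N (fst (p j))) (\<lambda>j. place b N (snd (p j))))
        = (\<Prod>j\<in>UNIV. case p j of (c, c') \<Rightarrow> ?r j c c')" by (simp only: case_prod_beta)
  qed
  also have "\<dots> = (\<Prod>j\<in>UNIV. \<Sum>(c, c')\<in>J j \<times> J j. ?r j c c')"
    by (subst prod_sum_PiE) (use fin in auto)
  also have "\<dots> \<le> (\<Prod>j\<in>UNIV. real b ^ Suc (\<gamma> j) *
     (1 / (real b ^ N)\<^sup>2 * energy (J j) b N (\<gamma> j) - 1 / (real b ^ N)\<^sup>2 * energy (J j) b N (Suc (\<gamma> j))) / (real b - 1))"
    using sum_atom_factors[OF b2 \<gamma>(3) J] b2
    by (intro prod_mono conjI sum_nonneg) (auto intro!: prod_nonneg)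
  finally show ?thesis .
qed

end

section \<open>Digits, nets and boxes\<close>

lemma floor_base_step:
  fixes x :: real
  assumes "0 < b"
  shows "\<lfloor>real b ^ Suc k * x\<rfloor> = int b * \<lfloor>real b ^ k * x\<rfloor> + int (digit b (Suc k) x)"
proof -
  define z where "z = real b ^ k * x"
  have "of_int (int b * \<lfloor>z\<rfloor>) \<le> real b * z" using assms by simp
  then have lo: "int b * \<lfloor>z\<rfloor> \<le> \<lfloor>real b * z\<rfloor>" by (simp only: le_floor_iff)
  have "z < of_int \<lfloor>z\<rfloor> + 1" by linarith
  then have "real b * z < real b * (of_int \<lfloor>z\<rfloor> + 1)" using assms by simp
  then have "real b * z < of_int (int b * \<lfloor>z\<rfloor> + int b)" by (simp add: distrib_left)
  then have hi: "\<lfloor>real b * z\<rfloor> < int b * \<lfloor>z\<rfloor> + int b" by (simp only: floor_less_iff)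
  have "\<lfloor>real b * z\<rfloor> mod int b = \<lfloor>real b * z\<rfloor> - int b * \<lfloor>z\<rfloor>"
    by (rule int_mod_pos_eq[of _ _ "\<lfloor>z\<rfloor>"]) (use lo hi in auto)
  then show ?thesis using assms lo by (simp add: digit_def z_def mult.assoc)
qed

lemma digit_less: "0 < b \<Longrightarrow> digit b i x < b"
  by (simp add: digit_def nat_less_iff)

lemma floors_agree_iff_digits_agree:
  fixes x y :: real
  assumes "0 < b" "0 \<le> x" "x < 1" "0 \<le> y" "y < 1"
  shows "\<lfloor>real b ^ k * x\<rfloor> = \<lfloor>real b ^ k * y\<rfloor> \<longleftrightarrow> (\<forall>i<k. digit b (Suc i) x = digit b (Suc i) y)"
proof (induction k)
  case 0
  have "\<lfloor>x\<rfloor> = 0" "\<lfloor>y\<rfloor> = 0" using assms by (simp_all add: floor_unique)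
  then show ?case by simp
next
  case (Suc k)
  have uniq: "int b * p + int r = int b * q + int s \<longleftrightarrow> p = q \<and> r = s" if "r < b" "s < b" for p q r s
  proof
    assume e: "int b * p + int r = int b * q + int s"
    have "(int b * p + int r) div int b = p" "(int b * q + int s) div int b = q" using that by simp_all
    then show "p = q \<and> r = s" using e by auto
  qed simp
  show ?case unfolding floor_base_step[OF assms(1)] uniq[OF digit_less[OF assms(1)] digit_less[OF assms(1)]] Suc
    by (auto simp: less_Suc_eq)
qed

text \<open>The upper bound is not strict: if all later digits are b - 1, the value is the right end
  of its cell. Admitting this case removes the need for an almost-sure argument later.\<close>

lemma horner_scaled_bounds:
  assumes b: "2 \<le> b" and d: "\<And>i. d i < b"
  shows "real (horner b d N) \<le> real b ^ N * (\<Sum>i. real (d i) / real b ^ Suc i)"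
    and "real b ^ N * (\<Sum>i. real (d i) / real b ^ Suc i) \<le> real (horner b d N) + 1"
proof -
  have b1: "1 < real b" using b by simp
  let ?f = "\<lambda>i. real (d i) / real b ^ Suc i"
  have geo: "(\<lambda>i. (real b - 1) / real b ^ Suc i) sums 1"
  proof -
    have "(\<lambda>i. (1 / real b) ^ i) sums (1 / (1 - 1 / real b))" using b1 by (intro geometric_sums) simp
    from sums_mult[OF this, of "(real b - 1) / real b"] show ?thesis
      using b1 by (simp add: power_divide field_simps)
  qed
  have le: "?f i \<le> (real b - 1) / real b ^ Suc i" for i
    using d[of i] b1 by (intro divide_right_mono) auto
  have nonneg: "0 \<le> ?f i" for i by simp
  have sum: "summable ?f"
    by (rule summable_comparison_test'[OF sums_summable[OF geo], of 0]) (use le in auto)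
  have part: "(\<Sum>i<N. ?f i) = real (horner b d N) / real b ^ N"
  proof (induction N)
    case (Suc N)
    then show ?case using b1 by (simp add: field_simps)
  qed simp
  have split: "suminf ?f = (\<Sum>i. ?f (i + N)) + (\<Sum>i<N. ?f i)"
    by (rule suminf_split_initial_segment[OF sum])
  have sumN: "summable (\<lambda>i. ?f (i + N))" by (rule summable_ignore_initial_segment[OF sum])
  have tail0: "0 \<le> (\<Sum>i. ?f (i + N))" by (rule suminf_nonneg[OF sumN]) simp
  have geoN: "(\<lambda>i. (real b - 1) / real b ^ Suc i / real b ^ N) sums (1 / real b ^ N)"
    by (rule sums_divide[OF geo])
  have "(\<Sum>i. ?f (i + N)) \<le> (\<Sum>i. (real b - 1) / real b ^ Suc i / real b ^ N)"
  proof (rule suminf_le[OF _ sumN sums_summable[OF geoN]])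
    fix i show "?f (i + N) \<le> (real b - 1) / real b ^ Suc i / real b ^ N"
      using le[of "i + N"] by (simp add: power_add mult.assoc)
  qed
  then have tail1: "(\<Sum>i. ?f (i + N)) \<le> 1 / real b ^ N" using sums_unique[OF geoN] by simp
  have pos: "0 < real b ^ N" using b1 by simp
  have eq: "real b ^ N * suminf ?f = real (horner b d N) + real b ^ N * (\<Sum>i. ?f (i + N))"
    unfolding split part using pos by (simp add: distrib_left)
  show "real (horner b d N) \<le> real b ^ N * suminf ?f"
    unfolding eq using tail0 pos by simp
  show "real b ^ N * suminf ?f \<le> real (horner b d N) + 1"
  proof -
    have "(\<Sum>i. ?f (i + N)) * real b ^ N \<le> 1" using tail1 by (simp only: pos_le_divide_eq[OF pos])
    then show ?thesis unfolding eq by (simp only: mult.commute add_left_mono)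
  qed
qed

text \<open>Brings a vector prescribing too many digits down to total m, where the net property
  still gives a count.\<close>

lemma exists_sum_eq_below:
  fixes t :: "'s::finite \<Rightarrow> nat"
  assumes "m \<le> (\<Sum>j\<in>UNIV. t j)"
  shows "\<exists>t'. (\<forall>j. t' j \<le> t j) \<and> (\<Sum>j\<in>UNIV. t' j) = m"
  using assms
proof (induction m)
  case 0
  then show ?case by (intro exI[of _ "\<lambda>_. 0"]) simp
next
  case (Suc m)
  then obtain t' where t': "\<forall>j. t' j \<le> t j" "(\<Sum>j\<in>UNIV. t' j) = m" by auto
  have "\<exists>j. t' j < t j"
  proof (rule ccontr)
    assume "\<not> ?thesis"
    then have "(\<Sum>j\<in>UNIV. t j) \<le> (\<Sum>j\<in>UNIV. t' j)" by (intro sum_mono) (simp add: not_less)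
    then show False using t' Suc.prems by simp
  qed
  then obtain j where j: "t' j < t j" by blast
  have "(\<Sum>i\<in>UNIV. (t'(j := Suc (t' j))) i) = Suc m"
    using t'(2) by (simp add: sum.remove[of UNIV j])
  then show ?case using t'(1) j by (intro exI[of _ "t'(j := Suc (t' j))"]) auto
qed

definition agreeing_pairs :: "nat \<Rightarrow> nat \<Rightarrow> (nat \<Rightarrow> real ^ 's::finite) \<Rightarrow> ('s \<Rightarrow> nat) \<Rightarrow> (nat \<times> nat) set" where
  "agreeing_pairs b n u t = {(i, l) \<in> distinct_pairs n. \<forall>j. \<lfloor>real b ^ t j * u i $ j\<rfloor> = \<lfloor>real b ^ t j * u l $ j\<rfloor>}"

lemma net_unit_cube:
  assumes "zero_net b m (u ` {1..n})" "i \<in> {1..n}"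
  shows "0 \<le> u i $ j" "u i $ j < 1"
  using assms unfolding zero_net_def hbox_def by (auto simp: image_subset_iff)

lemma net_cell_count:
  fixes u :: "nat \<Rightarrow> real ^ 's::finite"
  assumes b: "0 < b" and n: "n = b ^ m" and net: "zero_net b m (u ` {1..n})" and i: "i \<in> {1..n}"
    and t: "(\<Sum>j\<in>UNIV. t j) \<le> m"
  shows "card {l \<in> {1..n}. \<forall>j. \<lfloor>real b ^ t j * u i $ j\<rfloor> = \<lfloor>real b ^ t j * u l $ j\<rfloor>} = b ^ (m - (\<Sum>j\<in>UNIV. t j))"
proof -
  have inj: "inj_on u {1..n}"
    using net n by (intro eq_card_imp_inj_on) (simp_all add: zero_net_def)
  define c where "c j = nat \<lfloor>real b ^ t j * u i $ j\<rfloor>" for j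
  have cint: "int (c j) = \<lfloor>real b ^ t j * u i $ j\<rfloor>" for j
    using net_unit_cube[OF net i, of j] by (simp add: c_def)
  have c: "c j < b ^ t j" for j
  proof -
    have "real b ^ t j * u i $ j < real b ^ t j" using net_unit_cube[OF net i, of j] b by simp
    then have "\<lfloor>real b ^ t j * u i $ j\<rfloor> < int (b ^ t j)" by (simp add: floor_less_iff)
    then show ?thesis using cint[of j] by linarith
  qed
  let ?box = "hbox (\<chi> j. real (c j) / real b ^ t j) (\<chi> j. (real (c j) + 1) / real b ^ t j) :: (real ^ 's) set"
  have mem: "v \<in> ?box \<longleftrightarrow> (\<forall>j. int (c j) = \<lfloor>real b ^ t j * v $ j\<rfloor>)" for v
  proof -
    have "v $ j \<in> {real (c j) / real b ^ t j..<(real (c j) + 1) / real b ^ t j} \<longleftrightarrow> int (c j) = \<lfloor>real b ^ t j * v $ j\<rfloor>" for j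
    proof -
      have "v $ j \<in> {real (c j) / real b ^ t j..<(real (c j) + 1) / real b ^ t j}
         \<longleftrightarrow> real (c j) \<le> real b ^ t j * v $ j \<and> real b ^ t j * v $ j < real (c j) + 1"
        using b by (simp add: field_simps)
      also have "\<dots> \<longleftrightarrow> \<lfloor>real b ^ t j * v $ j\<rfloor> = int (c j)" by (simp add: floor_eq_iff)
      finally show ?thesis by (simp only: eq_commute)
    qed
    then show ?thesis by (simp add: hbox_def)
  qed
  let ?S = "{l \<in> {1..n}. \<forall>j. \<lfloor>real b ^ t j * u i $ j\<rfloor> = \<lfloor>real b ^ t j * u l $ j\<rfloor>}"
  have im: "u ` ?S = u ` {1..n} \<inter> ?box"
    by (auto simp: mem cint)
  have "card ?S = card (u ` ?S)"
    by (rule card_image[OF inj_on_subset[OF inj], symmetric]) blast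
  also have "\<dots> = card (u ` {1..n} \<inter> ?box)" unfolding im ..
  also have "\<dots> = b ^ (m - (\<Sum>j\<in>UNIV. t j))"
    using net t c unfolding zero_net_def by blast
  finally show ?thesis .
qed

text \<open>With |t| the sum of \<open>t\<close>: for |t| <= m each point has
  \<open>b ^ (m - |t|) - 1\<close> partners in its elementary interval, and the factor
  \<open>b ^ |t|\<close> clears the exponent. For |t| > m agreement would imply agreement at some
  smaller vector of total m, where there are no partners; \<open>min\<close> makes the right side
  vanish too.\<close>

lemma net_agreeing_pairs:
  fixes u :: "nat \<Rightarrow> real ^ 's::finite"
  assumes b: "2 \<le> b" and n: "n = b ^ m" and net: "zero_net b m (u ` {1..n})"
  shows "real (card (agreeing_pairs b n u t)) * (\<Prod>j\<in>UNIV. real b ^ t j)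
    = real b ^ m * (real b ^ m - real b ^ min m (\<Sum>j\<in>UNIV. t j))"
proof -
  have b0: "0 < b" using b by simp
  let ?agree = "\<lambda>t i l. \<forall>j. \<lfloor>real b ^ t j * u i $ j\<rfloor> = \<lfloor>real b ^ t j * u l $ j\<rfloor>"
  have count: "card (agreeing_pairs b n u t) = n * (b ^ (m - (\<Sum>j\<in>UNIV. t j)) - 1)" if t: "(\<Sum>j\<in>UNIV. t j) \<le> m" for t
  proof -
    have "agreeing_pairs b n u t = Sigma {1..n} (\<lambda>i. {l \<in> {1..n}. ?agree t i l} - {i})"
      by (auto simp: agreeing_pairs_def distinct_pairs_def)
    also have "card \<dots> = (\<Sum>i\<in>{1..n}. card ({l \<in> {1..n}. ?agree t i l} - {i}))" by simp
    also have "\<dots> = (\<Sum>i\<in>{1..n}. b ^ (m - (\<Sum>j\<in>UNIV. t j)) - 1)"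
    proof (rule sum.cong[OF refl])
      fix i assume i: "i \<in> {1..n}"
      show "card ({l \<in> {1..n}. ?agree t i l} - {i}) = b ^ (m - (\<Sum>j\<in>UNIV. t j)) - 1"
        using net_cell_count[OF b0 n net i t] i by simp
    qed
    finally show ?thesis by simp
  qed
  show ?thesis
  proof (cases "(\<Sum>j\<in>UNIV. t j) \<le> m")
    case True
    define S where "S = (\<Sum>j\<in>UNIV. t j)"
    have W: "(\<Prod>j\<in>UNIV. real b ^ t j) = real b ^ S" by (simp add: power_sum S_def)
    have m: "real b ^ m = real b ^ (m - S) * real b ^ S"
      using True by (simp add: S_def flip: power_add)
    have "real (card (agreeing_pairs b n u t)) = real b ^ m * (real b ^ (m - S) - 1)"
      using count[OF True] b0 by (simp add: n of_nat_diff S_def)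
    then have "real (card (agreeing_pairs b n u t)) * real b ^ S = real b ^ m * (real b ^ (m - S) * real b ^ S - real b ^ S)"
      by (simp only: mult.assoc left_diff_distrib mult_1_left)
    then show ?thesis using True unfolding W m[symmetric] by (simp add: S_def min_absorb2)
  next
    case False
    then obtain t' where t': "\<forall>j. t' j \<le> t j" "(\<Sum>j\<in>UNIV. t' j) = m" using exists_sum_eq_below[of m t] by auto
    have "agreeing_pairs b n u t \<subseteq> agreeing_pairs b n u t'"
      unfolding agreeing_pairs_def
    proof clarify
      fix i l j assume il: "(i, l) \<in> distinct_pairs n" and ag: "?agree t i l"
      have cube: "0 \<le> u i $ j" "u i $ j < 1" "0 \<le> u l $ j" "u l $ j < 1"
        using il net_unit_cube[OF net] by (auto simp: distinct_pairs_def)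
      show "\<lfloor>real b ^ t' j * u i $ j\<rfloor> = \<lfloor>real b ^ t' j * u l $ j\<rfloor>"
        using ag[rule_format, of j] t'(1)[rule_format, of j]
        unfolding floors_agree_iff_digits_agree[OF b0 cube] by auto
    qed
    moreover have "card (agreeing_pairs b n u t') = 0" using t'(2) by (simp add: count)
    moreover have "finite (agreeing_pairs b n u t')"
      by (rule finite_subset[of _ "{1..n} \<times> {1..n}"]) (auto simp: agreeing_pairs_def distinct_pairs_def)
    ultimately have "agreeing_pairs b n u t = {}" by auto
    then show ?thesis using False by simp
  qed
qed

text \<open>The half-open box lies between the open and the closed box, which have equal
  measure.\<close>

lemma measure_lborel_hbox:
  fixes a B :: "real ^ 's::finite"
  assumes "\<And>j. a $ j \<le> B $ j"
  shows "hbox a B \<in> sets borel" and "emeasure lborel (hbox a B) = ennreal (\<Prod>j\<in>UNIV. B $ j - a $ j)"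
proof -
  have "hbox a B = (\<Inter>j. {x. a $ j \<le> x $ j} \<inter> {x. x $ j < B $ j})" by (auto simp: hbox_def)
  also have "\<dots> \<in> sets borel" by measurable
  finally show m: "hbox a B \<in> sets borel" .
  have cb: "measure lborel (cbox a B) = (\<Prod>j\<in>UNIV. B $ j - a $ j)"
    by (rule content_cbox_cart) (use assms in \<open>auto simp: interval_ne_empty_cart\<close>)
  have e1: "emeasure lborel (cbox a B) = ennreal (\<Prod>j\<in>UNIV. B $ j - a $ j)"
    unfolding cb[symmetric] by (rule emeasure_eq_ennreal_measure) (use emeasure_lborel_cbox_finite[of a B] in simp)
  have e2: "emeasure lborel (box a B) = emeasure lborel (cbox a B)"
    by (simp add: emeasure_lborel_box_eq emeasure_lborel_cbox_eq)
  have "emeasure lborel (hbox a B) \<le> emeasure lborel (cbox a B)"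
    by (rule emeasure_mono) (auto simp: hbox_def mem_box_cart less_imp_le)
  moreover have "emeasure lborel (box a B) \<le> emeasure lborel (hbox a B)"
    by (rule emeasure_mono) (use m in \<open>auto simp: hbox_def mem_box_cart less_imp_le\<close>)
  ultimately show "emeasure lborel (hbox a B) = ennreal (\<Prod>j\<in>UNIV. B $ j - a $ j)"
    unfolding e2 e1 by (rule antisym)
qed

lemma measure_lborel_hbox_Times:
  fixes a B :: "real ^ 's::finite"
  assumes "\<And>j. a $ j \<le> B $ j"
  shows "measure lborel (hbox a B) = (\<Prod>j\<in>UNIV. B $ j - a $ j)"
    and "measure lborel (hbox a B \<times> hbox a B) = (measure lborel (hbox a B))\<^sup>2"
proof -
  note h = measure_lborel_hbox[OF assms]
  have p: "0 \<le> (\<Prod>j\<in>UNIV. B $ j - a $ j)" using assms by (intro prod_nonneg) simp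
  show m: "measure lborel (hbox a B) = (\<Prod>j\<in>UNIV. B $ j - a $ j)" using h(2) p by (simp add: measure_def)
  have "emeasure (lborel \<Otimes>\<^sub>M lborel) (hbox a B \<times> hbox a B) = emeasure lborel (hbox a B) * emeasure lborel (hbox a B)"
    using h(1) by (intro lborel.emeasure_pair_measure_Times) auto
  then have "emeasure lborel (hbox a B \<times> hbox a B) = ennreal ((\<Prod>j\<in>UNIV. B $ j - a $ j)\<^sup>2)"
    unfolding lborel_prod h(2) using p by (simp add: ennreal_mult power2_eq_square)
  then show "measure lborel (hbox a B \<times> hbox a B) = (measure lborel (hbox a B))\<^sup>2"
    unfolding m using p by (simp add: measure_def)
qed

section \<open>Pairs of net points\<close>

text \<open>The number of common leading digits, as digits are numbered from 1. It is used only for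
  expansions that differ, as those of two net points do in every coordinate.\<close>

definition agreement :: "nat \<Rightarrow> real \<Rightarrow> real \<Rightarrow> nat" where
  "agreement b x y = (LEAST i. digit b (Suc i) x \<noteq> digit b (Suc i) y)"

lemma agreement_iff:
  assumes b: "0 < b" and xy: "0 \<le> x" "x < 1" "0 \<le> y" "y < 1"
    and ne: "\<lfloor>real b ^ m * x\<rfloor> \<noteq> \<lfloor>real b ^ m * y\<rfloor>"
  shows "\<And>i. i < agreement b x y \<Longrightarrow> digit b (Suc i) x = digit b (Suc i) y"
    and "digit b (Suc (agreement b x y)) x \<noteq> digit b (Suc (agreement b x y)) y"
    and "agreement b x y < m"
    and "\<lfloor>real b ^ k * x\<rfloor> = \<lfloor>real b ^ k * y\<rfloor> \<longleftrightarrow> k \<le> agreement b x y"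
proof -
  obtain i where i: "i < m" "digit b (Suc i) x \<noteq> digit b (Suc i) y"
    using ne unfolding floors_agree_iff_digits_agree[OF b xy] by blast
  show 1: "digit b (Suc i) x = digit b (Suc i) y" if "i < agreement b x y" for i
    using not_less_Least[of i] that unfolding agreement_def by blast
  show 2: "digit b (Suc (agreement b x y)) x \<noteq> digit b (Suc (agreement b x y)) y"
    unfolding agreement_def by (rule LeastI[of "\<lambda>i. digit b (Suc i) x \<noteq> digit b (Suc i) y"]) (rule i(2))
  have "agreement b x y \<le> i"
    unfolding agreement_def by (rule Least_le) (rule i(2))
  then show "agreement b x y < m" using i(1) by simp
  show "\<lfloor>real b ^ k * x\<rfloor> = \<lfloor>real b ^ k * y\<rfloor> \<longleftrightarrow> k \<le> agreement b x y"
    unfolding floors_agree_iff_digits_agree[OF b xy]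
  proof
    assume "\<forall>i<k. digit b (Suc i) x = digit b (Suc i) y"
    then show "k \<le> agreement b x y" using 2 by (meson not_le)
  next
    assume "k \<le> agreement b x y"
    then show "\<forall>i<k. digit b (Suc i) x = digit b (Suc i) y" using 1 by (meson less_le_trans)
  qed
qed

text \<open>Spending all m digits on one coordinate gives elementary intervals with exactly one net
  point each.\<close>

lemma net_coordinates_separate:
  fixes u :: "nat \<Rightarrow> real ^ 's::finite"
  assumes b: "2 \<le> b" and n: "n = b ^ m" and net: "zero_net b m (u ` {1..n})" and il: "(i, l) \<in> distinct_pairs n"
  shows "\<lfloor>real b ^ m * u i $ j\<rfloor> \<noteq> \<lfloor>real b ^ m * u l $ j\<rfloor>"
proof
  assume eq: "\<lfloor>real b ^ m * u i $ j\<rfloor> = \<lfloor>real b ^ m * u l $ j\<rfloor>"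
  define t where "t = (\<lambda>k. if k = j then m else 0)"
  have i: "i \<in> {1..n}" and l: "l \<in> {1..n}" "i \<noteq> l" using il by (auto simp: distinct_pairs_def)
  have tm: "(\<Sum>k\<in>UNIV. t k) = m" by (simp add: t_def)
  have "card {l \<in> {1..n}. \<forall>k. \<lfloor>real b ^ t k * u i $ k\<rfloor> = \<lfloor>real b ^ t k * u l $ k\<rfloor>} = 1"
    using net_cell_count[OF _ n net i, of t] b tm by simp
  moreover have "{i, l} \<subseteq> {l \<in> {1..n}. \<forall>k. \<lfloor>real b ^ t k * u i $ k\<rfloor> = \<lfloor>real b ^ t k * u l $ k\<rfloor>}"
  proof -
    have "\<lfloor>u i $ k\<rfloor> = 0" "\<lfloor>u l $ k\<rfloor> = 0" for k
      using net_unit_cube[OF net i, of k] net_unit_cube[OF net l(1), of k] by (simp_all add: floor_unique)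
    then show ?thesis using i l eq by (auto simp: t_def)
  qed
  then have "card {i, l} \<le> card {l \<in> {1..n}. \<forall>k. \<lfloor>real b ^ t k * u i $ k\<rfloor> = \<lfloor>real b ^ t k * u l $ k\<rfloor>}"
    by (intro card_mono) simp_all
  ultimately show False using l by simp
qed

lemma finite_distinct_pairs: "finite (distinct_pairs n)"
  by (rule finite_subset[of _ "{1..n} \<times> {1..n}"]) (auto simp: distinct_pairs_def)

lemma card_distinct_pairs: "card (distinct_pairs n) = n * (n - 1)"
proof -
  have "distinct_pairs n = Sigma {1..n} (\<lambda>i. {1..n} - {i})" by (auto simp: distinct_pairs_def)
  then show ?thesis by simp
qed

lemma net_pair_sum_le:
  fixes u :: "nat \<Rightarrow> real ^ 's::finite"
  assumes b: "2 \<le> b" and s: "CARD('s) \<le> b" and n: "n = b ^ m" and net: "zero_net b m (u ` {1..n})"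
    and N: "m \<le> N" and J: "\<And>j. \<alpha> j < \<beta> j" "\<And>j. \<beta> j \<le> b ^ N"
  shows "(\<Sum>(i, l)\<in>distinct_pairs n. \<Prod>j\<in>UNIV. real b ^ Suc (agreement b (u i $ j) (u l $ j)) *
     (1 / (real b ^ N)\<^sup>2 * energy {\<alpha> j..<\<beta> j} b N (agreement b (u i $ j) (u l $ j))
       - 1 / (real b ^ N)\<^sup>2 * energy {\<alpha> j..<\<beta> j} b N (Suc (agreement b (u i $ j) (u l $ j)))) / (real b - 1))
    \<le> real (card (distinct_pairs n)) * (\<Prod>j\<in>UNIV. (real (\<beta> j - \<alpha> j) / real b ^ N)\<^sup>2)"
proof -
  let ?\<gamma> = "\<lambda>i l j. agreement b (u i $ j) (u l $ j)"
  define C where "C j k = 1 / (real b ^ N)\<^sup>2 * energy {\<alpha> j..<\<beta> j} b N k" for j k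
  define h where "h j = weight b m (C j)" for j
  have b0: "0 < b" using b by simp
  have signed: "mildly_signed b m (h j)" for j
    unfolding h_def C_def[abs_def] by (rule interval_weight_mildly_signed[OF b N J]) simp
  have total: "(\<Sum>t\<le>m. h j t) = (real (\<beta> j - \<alpha> j) / real b ^ N)\<^sup>2" for j
  proof -
    have "(\<Sum>t\<le>m. h j t) = C j 0"
      using sum_weight[of 0 m b "C j"] by (simp add: h_def tail_weight_def atLeast0AtMost)
    also have "energy {\<alpha> j..<\<beta> j} b N 0 = (real (\<beta> j - \<alpha> j))\<^sup>2"
      by (rule energy_one_cell[OF b0 _ J]) (use J[of j] in auto)
    then have "C j 0 = (real (\<beta> j - \<alpha> j) / real b ^ N)\<^sup>2" by (simp add: C_def power_divide)
    finally show ?thesis .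
  qed
  have agree: "?\<gamma> i l j < m" "\<lfloor>real b ^ k * u i $ j\<rfloor> = \<lfloor>real b ^ k * u l $ j\<rfloor> \<longleftrightarrow> k \<le> ?\<gamma> i l j"
    if "(i, l) \<in> distinct_pairs n" for i l j k
  proof -
    have il: "i \<in> {1..n}" "l \<in> {1..n}" using that by (auto simp: distinct_pairs_def)
    note a = agreement_iff[OF b0 net_unit_cube[OF net il(1)] net_unit_cube[OF net il(2)] net_coordinates_separate[OF b n net that]]
    show "?\<gamma> i l j < m" by (rule a(3))
    show "\<lfloor>real b ^ k * u i $ j\<rfloor> = \<lfloor>real b ^ k * u l $ j\<rfloor> \<longleftrightarrow> k \<le> ?\<gamma> i l j" by (rule a(4))
  qed
  let ?P = "PiE UNIV (\<lambda>_. {..m}) :: ('s \<Rightarrow> nat) set"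
  let ?w = "\<lambda>t. \<Prod>j\<in>UNIV. real b ^ t j * h j (t j)"
  \<comment> \<open>Expanding the product of prefix sums gives one term for each \<open>t\<close>
    that is at most the agreement in every coordinate, that is, for each \<open>t\<close> at which
    the pair agrees.\<close>
  have pair: "(\<Prod>j\<in>UNIV. real b ^ Suc (?\<gamma> i l j) * (C j (?\<gamma> i l j) - C j (Suc (?\<gamma> i l j))) / (real b - 1))
      = (\<Sum>t\<in>?P. if (i, l) \<in> agreeing_pairs b n u t then ?w t else 0)" if il: "(i, l) \<in> distinct_pairs n" for i l
  proof -
    have "(\<Prod>j\<in>UNIV. real b ^ Suc (?\<gamma> i l j) * (C j (?\<gamma> i l j) - C j (Suc (?\<gamma> i l j))) / (real b - 1))
      = (\<Prod>j\<in>UNIV. \<Sum>k\<le>m. if k \<le> ?\<gamma> i l j then real b ^ k * h j k else 0)"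
    proof (rule prod.cong[OF refl])
      fix j
      have lt: "?\<gamma> i l j < m" by (rule agree(1)[OF il])
      have "(\<Sum>k\<le>m. if k \<le> ?\<gamma> i l j then real b ^ k * h j k else 0) = (\<Sum>k\<le>?\<gamma> i l j. real b ^ k * h j k)"
        by (rule sum.mono_neutral_cong_right) (use lt in auto)
      then show "real b ^ Suc (?\<gamma> i l j) * (C j (?\<gamma> i l j) - C j (Suc (?\<gamma> i l j))) / (real b - 1)
         = (\<Sum>k\<le>m. if k \<le> ?\<gamma> i l j then real b ^ k * h j k else 0)"
        unfolding h_def weighted_prefix_sum[OF b lt] by simp
    qed
    also have "\<dots> = (\<Sum>t\<in>?P. \<Prod>j\<in>UNIV. if t j \<le> ?\<gamma> i l j then real b ^ t j * h j (t j) else 0)"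
      by (rule prod_sum_PiE) auto
    also have "\<dots> = (\<Sum>t\<in>?P. if (i, l) \<in> agreeing_pairs b n u t then ?w t else 0)"
    proof (rule sum.cong[OF refl])
      fix t :: "'s \<Rightarrow> nat"
      have mem: "(i, l) \<in> agreeing_pairs b n u t \<longleftrightarrow> (\<forall>j. t j \<le> ?\<gamma> i l j)"
        using il agree(2)[OF il] by (simp add: agreeing_pairs_def)
      show "(\<Prod>j\<in>UNIV. if t j \<le> ?\<gamma> i l j then real b ^ t j * h j (t j) else 0)
        = (if (i, l) \<in> agreeing_pairs b n u t then ?w t else 0)"
      proof (cases "\<forall>j. t j \<le> ?\<gamma> i l j")
        case True
        then show ?thesis by (simp add: mem)
      next
        case False
        then obtain j where "\<not> t j \<le> ?\<gamma> i l j" by blast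
        then have "(\<Prod>j\<in>UNIV. if t j \<le> ?\<gamma> i l j then real b ^ t j * h j (t j) else 0) = 0"
          by (intro prod_zero) auto
        then show ?thesis using False by (simp only: mem if_False)
      qed
    qed
    finally show ?thesis .
  qed
  have "(\<Sum>(i, l)\<in>distinct_pairs n. \<Prod>j\<in>UNIV. real b ^ Suc (?\<gamma> i l j) * (C j (?\<gamma> i l j) - C j (Suc (?\<gamma> i l j))) / (real b - 1))
     = (\<Sum>p\<in>distinct_pairs n. \<Sum>t\<in>?P. if p \<in> agreeing_pairs b n u t then ?w t else 0)"
  proof (rule sum.cong[OF refl])
    fix p assume p: "p \<in> distinct_pairs n"
    obtain i l where il: "p = (i, l)" by (cases p)
    show "(case p of (i, l) \<Rightarrow> \<Prod>j\<in>UNIV. real b ^ Suc (?\<gamma> i l j) * (C j (?\<gamma> i l j) - C j (Suc (?\<gamma> i l j))) / (real b - 1))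
      = (\<Sum>t\<in>?P. if p \<in> agreeing_pairs b n u t then ?w t else 0)"
      using pair[of i l] p unfolding il by simp
  qed
  \<comment> \<open>After this exchange the net enters only through the number of pairs agreeing at
    \<open>t\<close>, which is known exactly.\<close>
  also have "\<dots> = (\<Sum>t\<in>?P. \<Sum>p\<in>distinct_pairs n. if p \<in> agreeing_pairs b n u t then ?w t else 0)"
    by (rule sum.swap)
  also have "\<dots> = (\<Sum>t\<in>?P. real b ^ m * ((real b ^ m - real b ^ min m (\<Sum>j\<in>UNIV. t j)) * (\<Prod>j\<in>UNIV. h j (t j))))"
  proof (rule sum.cong[OF refl])
    fix t :: "'s \<Rightarrow> nat"
    have sub: "agreeing_pairs b n u t \<subseteq> distinct_pairs n" by (auto simp: agreeing_pairs_def)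
    have "(\<Sum>p\<in>distinct_pairs n. if p \<in> agreeing_pairs b n u t then ?w t else 0) = (\<Sum>p\<in>agreeing_pairs b n u t. ?w t)"
      by (rule sum.mono_neutral_cong_right) (use finite_distinct_pairs sub in auto)
    also have "\<dots> = (real (card (agreeing_pairs b n u t)) * (\<Prod>j\<in>UNIV. real b ^ t j)) * (\<Prod>j\<in>UNIV. h j (t j))"
      by (simp add: prod.distrib mult.assoc)
    finally show "(\<Sum>p\<in>distinct_pairs n. if p \<in> agreeing_pairs b n u t then ?w t else 0)
       = real b ^ m * ((real b ^ m - real b ^ min m (\<Sum>j\<in>UNIV. t j)) * (\<Prod>j\<in>UNIV. h j (t j)))"
      unfolding net_agreeing_pairs[OF b n net] by (simp only: mult.assoc)
  qed
  also have "\<dots> \<le> real b ^ m * ((real b ^ m - 1) * (\<Prod>j\<in>UNIV. \<Sum>t\<le>m. h j t))"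
    unfolding sum_distrib_left[symmetric]
    by (intro mult_left_mono truncated_power_convolution[OF b s signed]) simp
  \<comment> \<open>The factors \<open>b ^ m\<close> and \<open>b ^ m - 1\<close> are
    \<open>n\<close> and \<open>n - 1\<close>.\<close>
  also have "\<dots> = real (card (distinct_pairs n)) * (\<Prod>j\<in>UNIV. (real (\<beta> j - \<alpha> j) / real b ^ N)\<^sup>2)"
    using b0 unfolding total card_distinct_pairs n by (simp add: of_nat_diff)
  finally show ?thesis unfolding C_def .
qed

section \<open>From grid cells to arbitrary boxes\<close>

context scrambling begin

lemma scramble_coord_as_digits:
  "scramble_coord b (\<lambda>ds. \<pi> j ds \<omega>) (x $ j)
    = (\<Sum>i. real (scrambled_digit (\<lambda>j i. digit b (Suc i) (x $ j)) j i \<omega>) / real b ^ Suc i)"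
proof -
  have "map (\<lambda>k. digit b k (x $ j)) [1..<Suc i] = map (\<lambda>i. digit b (Suc i) (x $ j)) [0..<i]" for i
    by (simp only: map_Suc_upt[symmetric] One_nat_def map_map comp_def)
  then show ?thesis by (simp only: scramble_coord_def scrambled_digit_def)
qed

lemma scrambled_net_pair_prob_le_grid:
  fixes u :: "nat \<Rightarrow> real ^ 's" and a B :: "real ^ 's"
  assumes s: "CARD('s) \<le> b" and n: "n = b ^ m" and m: "1 \<le> m" and net: "zero_net b m (u ` {1..n})"
    and U: "\<And>i \<omega>. i \<in> {1..n} \<Longrightarrow> \<omega> \<in> space M \<Longrightarrow> U i \<omega> = scramble b (\<lambda>j ds. \<pi> j ds \<omega>) (u i)"
    and IL: "independent_uniform_pair M b n \<pi> I L"
    and box: "\<And>j. 0 \<le> a $ j" "\<And>j. a $ j < B $ j" "\<And>j. B $ j \<le> 1" and N: "m \<le> N"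
  shows "pair_prob M (\<lambda>\<omega>. U (I \<omega>) \<omega>) (\<lambda>\<omega>. U (L \<omega>) \<omega>) (hbox a B)
    \<le> (\<Prod>j\<in>UNIV. (B $ j - a $ j + 2 / real b ^ N)\<^sup>2)"
proof -
  \<comment> \<open>Not the floor: a scrambled value may be the right end of its cell, so a cell c
    counts as soon as \<open>b ^ N * a $ j <= c + 1\<close>. For \<open>a $ j = 0\<close> the
    ceiling minus one is -1, which \<open>nat\<close> sends to 0. The two roundings together add at
    most two cells, hence the term \<open>2 / b ^ N\<close>.\<close>
  define \<alpha> where "\<alpha> j = nat (\<lceil>real b ^ N * a $ j\<rceil> - 1)" for j
  define \<beta> where "\<beta> j = nat \<lceil>real b ^ N * B $ j\<rceil>" for j
  have b0: "0 < b" using b2 by simp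
  have bN: "0 < real b ^ N" using b0 by simp
  have Bpos: "0 < real b ^ N * B $ j" for j using box(1,2)[of j] bN by simp
  have aB: "real b ^ N * a $ j < real b ^ N * B $ j" for j using box(2)[of j] bN by simp
  have J1: "\<alpha> j < \<beta> j" for j
    using aB[of j] Bpos[of j] unfolding \<alpha>_def \<beta>_def by linarith
  have J2: "\<beta> j \<le> b ^ N" for j
  proof -
    have "real b ^ N * B $ j \<le> of_int (int (b ^ N))" using box(3)[of j] bN by simp
    then show ?thesis unfolding \<beta>_def by (simp add: ceiling_le_iff nat_le_iff)
  qed
  have width: "real (\<beta> j - \<alpha> j) / real b ^ N \<le> B $ j - a $ j + 2 / real b ^ N" for j
  proof -
    have "real (\<beta> j) \<le> real b ^ N * B $ j + 1" using Bpos[of j] unfolding \<beta>_def by linarith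
    moreover have "real b ^ N * a $ j - 1 \<le> real (\<alpha> j)" unfolding \<alpha>_def by linarith
    ultimately have "real (\<beta> j - \<alpha> j) \<le> real b ^ N * (B $ j - a $ j) + 2"
      using J1[of j] by (simp add: of_nat_diff right_diff_distrib)
    then have "real (\<beta> j - \<alpha> j) / real b ^ N \<le> (real b ^ N * (B $ j - a $ j) + 2) / real b ^ N"
      using bN by (intro divide_right_mono) auto
    also have "\<dots> = B $ j - a $ j + 2 / real b ^ N"
      by (simp only: add_divide_distrib nonzero_mult_div_cancel_left[OF less_imp_neq[OF bN, symmetric]])
    finally show ?thesis .
  qed
  define \<xi> where "\<xi> i = (\<lambda>j k. digit b (Suc k) (u i $ j))" for i
  have \<xi>: "\<xi> i j k < b" for i j k using b0 by (simp add: \<xi>_def digit_less)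
  define G where "G p = cell_event N (\<xi> (fst p)) (\<xi> (snd p)) (\<lambda>j. {\<alpha> j..<\<beta> j})" for p
  define W where "W p = {\<omega> \<in> space M. (I \<omega>, L \<omega>) = p}" for p
  have indep: "indep_set (sets perm_algebra)
      (sets (vimage_algebra (space M) (\<lambda>\<omega>. (I \<omega>, L \<omega>)) (count_space (distinct_pairs n))))"
    and meas: "(\<lambda>\<omega>. (I \<omega>, L \<omega>)) \<in> measurable M (count_space (distinct_pairs n))"
    and unif: "distr M (count_space (distinct_pairs n)) (\<lambda>\<omega>. (I \<omega>, L \<omega>)) = uniform_count_measure (distinct_pairs n)"
    using IL unfolding independent_uniform_pair_def perm_algebra_def by blast+
  have G: "G p \<in> sets perm_algebra" for p
    unfolding G_def by (rule cell_event_in_perm_algebra[OF \<xi> \<xi>]) simp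
  have Wv: "W p = (\<lambda>\<omega>. (I \<omega>, L \<omega>)) -` {p} \<inter> space M" for p by (auto simp: W_def)
  have W: "W p \<in> sets (vimage_algebra (space M) (\<lambda>\<omega>. (I \<omega>, L \<omega>)) (count_space (distinct_pairs n)))"
    if "p \<in> distinct_pairs n" for p
    unfolding Wv by (rule in_vimage_algebra) (use that in simp)
  have Wp: "prob (W p) = 1 / real (card (distinct_pairs n))" if p: "p \<in> distinct_pairs n" for p
  proof -
    have "prob (W p) = measure (distr M (count_space (distinct_pairs n)) (\<lambda>\<omega>. (I \<omega>, L \<omega>))) {p}"
      unfolding Wv using p by (subst measure_distr[OF meas]) auto
    then show ?thesis unfolding unif
      using p by (simp add: measure_uniform_count_measure finite_distinct_pairs)
  qed
  have events: "G p \<inter> W p \<in> events" if "p \<in> distinct_pairs n" for p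
    using G W[OF that] indep_setD_ev1[OF indep] indep_setD_ev2[OF indep] by blast
  have cell: "horner b (\<lambda>k. scrambled_digit (\<xi> i) j k \<omega>) N \<in> {\<alpha> j..<\<beta> j}"
    if i: "i \<in> {1..n}" and \<omega>: "\<omega> \<in> space M" and mem: "U i \<omega> \<in> hbox a B" for i j \<omega>
  proof -
    let ?x = "\<Sum>k. real (scrambled_digit (\<xi> i) j k \<omega>) / real b ^ Suc k"
    let ?c = "horner b (\<lambda>k. scrambled_digit (\<xi> i) j k \<omega>) N"
    have "U i \<omega> $ j = ?x"
      unfolding U[OF i \<omega>] scramble_def \<xi>_def by (simp only: vec_lambda_beta scramble_coord_as_digits)
    moreover have "a $ j \<le> U i \<omega> $ j" "U i \<omega> $ j < B $ j" using mem by (auto simp: hbox_def)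
    ultimately have x: "a $ j \<le> ?x" "?x < B $ j" by simp_all
    have "scrambled_digit (\<xi> i) j k \<omega> < b" for k by (rule scrambled_digit_less[OF \<xi> \<omega>])
    from horner_scaled_bounds[OF b2 this]
    have "real ?c \<le> real b ^ N * ?x" "real b ^ N * ?x \<le> real ?c + 1" by simp_all
    moreover have "real b ^ N * a $ j \<le> real b ^ N * ?x" "real b ^ N * ?x < real b ^ N * B $ j"
      using x bN by simp_all
    ultimately have "real b ^ N * a $ j \<le> real ?c + 1" "real ?c < real b ^ N * B $ j" by linarith+
    then show ?thesis unfolding \<alpha>_def \<beta>_def atLeastLessThan_iff by linarith
  qed
  have "pair_prob M (\<lambda>\<omega>. U (I \<omega>) \<omega>) (\<lambda>\<omega>. U (L \<omega>) \<omega>) (hbox a B) \<le> prob (\<Union>p\<in>distinct_pairs n. G p \<inter> W p)"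
    unfolding pair_prob_def
  proof (rule finite_measure_mono)
    show "(\<Union>p\<in>distinct_pairs n. G p \<inter> W p) \<in> events"
      by (intro sets.finite_UN finite_distinct_pairs events)
    show "{\<omega> \<in> space M. (U (I \<omega>) \<omega>, U (L \<omega>) \<omega>) \<in> hbox a B \<times> hbox a B} \<subseteq> (\<Union>p\<in>distinct_pairs n. G p \<inter> W p)"
    proof
      fix \<omega> assume "\<omega> \<in> {\<omega> \<in> space M. (U (I \<omega>) \<omega>, U (L \<omega>) \<omega>) \<in> hbox a B \<times> hbox a B}"
      then have \<omega>: "\<omega> \<in> space M" and mem: "U (I \<omega>) \<omega> \<in> hbox a B" "U (L \<omega>) \<omega> \<in> hbox a B" by auto
      have p: "(I \<omega>, L \<omega>) \<in> distinct_pairs n" using measurable_space[OF meas \<omega>] by simp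
      then have i: "I \<omega> \<in> {1..n}" "L \<omega> \<in> {1..n}" by (auto simp: distinct_pairs_def)
      have "\<omega> \<in> G (I \<omega>, L \<omega>)" unfolding G_def fst_conv snd_conv
        by (rule cell_eventI[OF \<xi> \<xi> \<omega> cell[OF i(1) \<omega> mem(1)] cell[OF i(2) \<omega> mem(2)]])
      then show "\<omega> \<in> (\<Union>p\<in>distinct_pairs n. G p \<inter> W p)" using p \<omega> by (auto simp: W_def)
    qed
  qed
  also have "\<dots> \<le> (\<Sum>p\<in>distinct_pairs n. prob (G p \<inter> W p))"
    by (intro finite_measure_subadditive_finite finite_distinct_pairs) (use events in auto)
  \<comment> \<open>For a fixed pair the cell event depends on the permutations alone, so
    independence splits off the probability of drawing that pair.\<close>
  also have "\<dots> = (\<Sum>p\<in>distinct_pairs n. prob (G p)) / real (card (distinct_pairs n))"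
    unfolding sum_divide_distrib
    by (rule sum.cong[OF refl]) (simp add: indep_setD[OF indep G W] Wp)
  also have "\<dots> \<le> (real (card (distinct_pairs n)) * (\<Prod>j\<in>UNIV. (real (\<beta> j - \<alpha> j) / real b ^ N)\<^sup>2)) / real (card (distinct_pairs n))"
  proof (rule divide_right_mono)
    show "(\<Sum>p\<in>distinct_pairs n. prob (G p)) \<le> real (card (distinct_pairs n)) * (\<Prod>j\<in>UNIV. (real (\<beta> j - \<alpha> j) / real b ^ N)\<^sup>2)"
    proof (rule order_trans[OF sum_mono net_pair_sum_le[OF b2 s n net N J1 J2]])
      fix p assume p: "p \<in> distinct_pairs n"
      obtain i l where pil: "p = (i, l)" by (cases p)
      have il: "(i, l) \<in> distinct_pairs n" "i \<in> {1..n}" "l \<in> {1..n}" using p pil by (auto simp: distinct_pairs_def)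
      note ag = agreement_iff[OF b0 net_unit_cube[OF net il(2)] net_unit_cube[OF net il(3)] net_coordinates_separate[OF b2 n net il(1)]]
      have "prob (G p) \<le> (\<Prod>j\<in>UNIV. real b ^ Suc (agreement b (u i $ j) (u l $ j)) *
         (1 / (real b ^ N)\<^sup>2 * energy {\<alpha> j..<\<beta> j} b N (agreement b (u i $ j) (u l $ j))
         - 1 / (real b ^ N)\<^sup>2 * energy {\<alpha> j..<\<beta> j} b N (Suc (agreement b (u i $ j) (u l $ j)))) / (real b - 1))"
        unfolding G_def pil fst_conv snd_conv
      proof (rule cell_event_prob_le[where \<gamma> = "\<lambda>j. agreement b (u i $ j) (u l $ j)", OF \<xi> \<xi>])
        show "\<xi> i j k = \<xi> l j k" if "k < agreement b (u i $ j) (u l $ j)" for j k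
          unfolding \<xi>_def by (rule ag(1)[OF that])
        show "\<xi> i j (agreement b (u i $ j) (u l $ j)) \<noteq> \<xi> l j (agreement b (u i $ j) (u l $ j))" for j
          unfolding \<xi>_def by (rule ag(2))
        show "agreement b (u i $ j) (u l $ j) < N" for j using ag(3)[of j] N by simp
        show "{\<alpha> j..<\<beta> j} \<subseteq> {..<b ^ N}" for j using J2[of j] by auto
      qed
      then show "prob (G p) \<le> (case p of (i, l) \<Rightarrow> \<Prod>j\<in>UNIV. real b ^ Suc (agreement b (u i $ j) (u l $ j)) *
         (1 / (real b ^ N)\<^sup>2 * energy {\<alpha> j..<\<beta> j} b N (agreement b (u i $ j) (u l $ j))
         - 1 / (real b ^ N)\<^sup>2 * energy {\<alpha> j..<\<beta> j} b N (Suc (agreement b (u i $ j) (u l $ j)))) / (real b - 1))"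
        unfolding pil by simp
    qed
  qed simp
  also have "\<dots> = (\<Prod>j\<in>UNIV. (real (\<beta> j - \<alpha> j) / real b ^ N)\<^sup>2)"
  proof -
    \<comment> \<open>Ensures that there are distinct pairs, so the division by their number can be
      cancelled.\<close>
    have "2 \<le> n" using b2 m n self_le_power[of b m] by simp
    then show ?thesis by (simp add: card_distinct_pairs)
  qed
  also have "\<dots> \<le> (\<Prod>j\<in>UNIV. (B $ j - a $ j + 2 / real b ^ N)\<^sup>2)"
    by (intro prod_mono conjI power_mono width) simp_all
  finally show ?thesis .
qed

lemma scrambled_net_pair_prob_le:
  fixes u :: "nat \<Rightarrow> real ^ 's" and a B :: "real ^ 's"
  assumes "CARD('s) \<le> b" "n = b ^ m" "1 \<le> m" "zero_net b m (u ` {1..n})"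
    and "\<And>i \<omega>. i \<in> {1..n} \<Longrightarrow> \<omega> \<in> space M \<Longrightarrow> U i \<omega> = scramble b (\<lambda>j ds. \<pi> j ds \<omega>) (u i)"
    and "independent_uniform_pair M b n \<pi> I L"
    and "\<And>j. 0 \<le> a $ j" "\<And>j. a $ j < B $ j" "\<And>j. B $ j \<le> 1"
  shows "pair_prob M (\<lambda>\<omega>. U (I \<omega>) \<omega>) (\<lambda>\<omega>. U (L \<omega>) \<omega>) (hbox a B) \<le> (\<Prod>j\<in>UNIV. B $ j - a $ j)\<^sup>2"
proof (rule LIMSEQ_le_const)
  have "(\<lambda>N. 2 * (1 / real b) ^ N) \<longlonglongrightarrow> 2 * 0"
    using b2 by (intro tendsto_mult tendsto_const LIMSEQ_realpow_zero) auto
  then have "(\<lambda>N. 2 / real b ^ N) \<longlonglongrightarrow> 0" by (simp add: power_divide)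
  then have "(\<lambda>N. \<Prod>j\<in>UNIV. (B $ j - a $ j + 2 / real b ^ N)\<^sup>2) \<longlonglongrightarrow> (\<Prod>j\<in>UNIV. (B $ j - a $ j + 0)\<^sup>2)"
    by (intro tendsto_prod tendsto_power tendsto_add tendsto_const)
  then show "(\<lambda>N. \<Prod>j\<in>UNIV. (B $ j - a $ j + 2 / real b ^ N)\<^sup>2) \<longlonglongrightarrow> (\<Prod>j\<in>UNIV. B $ j - a $ j)\<^sup>2"
    by (simp add: prod_power_distrib)
  show "\<exists>K. \<forall>N\<ge>K. pair_prob M (\<lambda>\<omega>. U (I \<omega>) \<omega>) (\<lambda>\<omega>. U (L \<omega>) \<omega>) (hbox a B)
      \<le> (\<Prod>j\<in>UNIV. (B $ j - a $ j + 2 / real b ^ N)\<^sup>2)"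
    using scrambled_net_pair_prob_le_grid[OF assms] by blast
qed

end

theorem theorem4:
  fixes b m n :: nat
    and u :: "nat \<Rightarrow> real ^ 's::finite"
    and M :: "'w measure"
    and \<pi> :: "'s \<Rightarrow> nat list \<Rightarrow> 'w \<Rightarrow> nat \<Rightarrow> nat"
    and I L :: "'w \<Rightarrow> nat"
    and U :: "nat \<Rightarrow> 'w \<Rightarrow> real ^ 's"
  assumes "2 \<le> b" and "1 \<le> m" and "CARD('s) \<le> b" and "n = b ^ m"
    and "zero_net b m (u ` {1..n})"
    and "prob_space M"
    and "nested_uniform_perms M b \<pi>"
    and "\<And>i \<omega>. i \<in> {1..n} \<Longrightarrow> \<omega> \<in> space M \<Longrightarrow> U i \<omega> = scramble b (\<lambda>j ds. \<pi> j ds \<omega>) (u i)"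
    and "independent_uniform_pair M b n \<pi> I L"
  shows "(\<forall>a B :: real ^ 's. (\<forall>j. 0 \<le> a $ j \<and> a $ j < B $ j \<and> B $ j \<le> 1) \<longrightarrow>
            pair_prob M (\<lambda>\<omega>. U (I \<omega>) \<omega>) (\<lambda>\<omega>. U (L \<omega>) \<omega>) (hbox a B)
              \<le> measure lborel (hbox a B \<times> hbox a B) \<and>
            measure lborel (hbox a B \<times> hbox a B) = (measure lborel (hbox a B))\<^sup>2) \<and>
         sampling_dependence_index M (\<lambda>\<omega>. U (I \<omega>) \<omega>) (\<lambda>\<omega>. U (L \<omega>) \<omega>) \<le> 0"
proof -
  interpret prob_space M by (rule assms(6))
  interpret scrambling M b \<pi> by unfold_locales (use assms in auto)
  have box: "pair_prob M (\<lambda>\<omega>. U (I \<omega>) \<omega>) (\<lambda>\<omega>. U (L \<omega>) \<omega>) (hbox a B) \<le> (measure lborel (hbox a B))\<^sup>2"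
    "measure lborel (hbox a B \<times> hbox a B) = (measure lborel (hbox a B))\<^sup>2"
    if "\<forall>j. 0 \<le> a $ j \<and> a $ j < B $ j \<and> B $ j \<le> 1" for a B :: "real ^ 's"
  proof -
    have le: "a $ j \<le> B $ j" for j using that by (simp add: less_imp_le)
    show "pair_prob M (\<lambda>\<omega>. U (I \<omega>) \<omega>) (\<lambda>\<omega>. U (L \<omega>) \<omega>) (hbox a B) \<le> (measure lborel (hbox a B))\<^sup>2"
      unfolding measure_lborel_hbox_Times(1)[OF le]
      by (rule scrambled_net_pair_prob_le[OF assms(3,4,2,5,8,9)]) (use that in auto)
    show "measure lborel (hbox a B \<times> hbox a B) = (measure lborel (hbox a B))\<^sup>2"
      by (rule measure_lborel_hbox_Times(2)[OF le])
  qed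
  \<comment> \<open>A least-upper-bound argument over the reals needs a nonempty family; the unit
    cube is a member.\<close>
  have "hbox (\<chi> j. 0) (\<chi> j. 1) \<in> (unit_boxes :: (real ^ 's) set set)"
    unfolding unit_boxes_def by (rule CollectI, intro exI conjI) auto
  then have "sampling_dependence_index M (\<lambda>\<omega>. U (I \<omega>) \<omega>) (\<lambda>\<omega>. U (L \<omega>) \<omega>) \<le> 0"
    unfolding sampling_dependence_index_def
  proof (intro cSUP_least)
    fix A :: "(real ^ 's) set" assume "A \<in> unit_boxes"
    then show "pair_prob M (\<lambda>\<omega>. U (I \<omega>) \<omega>) (\<lambda>\<omega>. U (L \<omega>) \<omega>) A - (measure lborel A)\<^sup>2 \<le> 0"
      using box(1) by (auto simp: unit_boxes_def)
  qed blast
  then show ?thesis using box by simp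
qed

end
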